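(* Let $\mathscr H,\mathscr K$ be complex Hilbert spaces, let $\Phi:\mathbb B(\mathscr H)\to\mathbb B(\mathscr K)$ be a (not necessarily linear) $2$-positive $*$-map and let $A,B,X,Y\in\mathbb B(\mathscr H)$ be arbitrary operators. If $\Phi(X^*A^*Y)=U|\Phi(X^*A^*Y)|$ is the polar decomposition of $\Phi(X^*A^*Y)$, and $\Phi(Y^*|A^*|Y)$ and $\Phi(X^*|A|X)$ are contractions, then $$I-|\Phi(X^*A^*Y)|\ \ge\ \Big(U^*\big(I-\Phi(X^*|A|X)\big)U\Big)\,\#\,\big(I-\Phi(Y^*|A^*|Y)\big).$$
   Context: $\mathbb B(\mathscr H)$ is the algebra of bounded linear operators on $\mathscr H$ and $I$ denotes the identity operator; $A\ge0$ means $\langle A\xi,\xi\rangle\ge0$ for all $\xi$, and $A\le B$ means $B-A\ge0$ for self-adjoint $A,B$. $|A|=(A^*A)^{1/2}$. A contraction is an operator of norm at most one. The polar decomposition of $A$ is $A=U|A|$ with $U$ the unique partial isometry with $\ker U=\ker|A|$. Maps $\Phi:\mathbb B(\mathscr H)\to\mathbb B(\mathscr K)$ are not assumed linear. $\Phi$ is $2$-positive if $\Phi_2([A_{ij}]_{2\times2})=[\Phi(A_{ij})]_{2\times2}$, as a map $\mathbb B(\mathscr H\oplus\mathscr H)\to\mathbb B(\mathscr K\oplus\mathscr K)$, sends every positive block matrix to a positive block matrix. $\Phi$ is a $*$-map if $\Phi(A^* )=\Phi(A)^*$ for all $A$. The geometric mean of positive operators $A,B$ on a Hilbert space is $$A\,\#\,B=\max\left\{X=X^*:\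 \begin{bmatrix}A&X\\ X&B\end{bmatrix}\ge0\right\}$$ (the maximum with respect to $\le$, which exists). *)

theory Defs
  imports "HOL-Analysis.Analysis"
begin

section \<open>Complex Hilbert spaces\<close>

text \<open>
  The underlying real Banach space supplies norm, topology and completeness; the last axiom
  says that its norm is the one induced by the inner product, which makes
  the inner product positive definite. The inner product is linear in its first argument.
  The zero space is allowed.
\<close>

class complex_hilbert_space = banach +
  fixes scaleC :: "complex \<Rightarrow> 'a \<Rightarrow> 'a"  (infixr \<open>*\<^sub>C\<close> 75)
    and cinner :: "'a \<Rightarrow> 'a \<Rightarrow> complex"
  assumes scaleC_add_right: "c *\<^sub>C (x + y) = c *\<^sub>C x + c *\<^sub>C y"
    and scaleC_add_left: "(c + d) *\<^sub>C x = c *\<^sub>C x + d *\<^sub>C x"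
    and scaleC_scaleC: "c *\<^sub>C (d *\<^sub>C x) = (c * d) *\<^sub>C x"
    and scaleR_scaleC: "r *\<^sub>R x = complex_of_real r *\<^sub>C x"
    and cinner_commute: "cinner y x = cnj (cinner x y)"
    and cinner_add_left: "cinner (x + y) z = cinner x z + cinner y z"
    and cinner_scaleC_left: "cinner (c *\<^sub>C x) y = c * cinner x y"
    and cinner_self: "cinner x x = complex_of_real ((norm x)\<^sup>2)"

lemma cinner_add_right:
  fixes x y z :: "'a::complex_hilbert_space"
  shows "cinner z (x + y) = cinner z x + cinner z y"
  by (subst (1 2 3) cinner_commute) (simp add: cinner_add_left)

lemma cinner_scaleC_right:
  fixes x y :: "'a::complex_hilbert_space"
  shows "cinner x (c *\<^sub>C y) = cnj c * cinner x y"
  by (subst (1 2) cinner_commute) (simp add: cinner_scaleC_left)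

instantiation complex :: complex_hilbert_space
begin

definition scaleC_complex :: "complex \<Rightarrow> complex \<Rightarrow> complex"
  where "scaleC_complex c x = c * x"

definition cinner_complex :: "complex \<Rightarrow> complex \<Rightarrow> complex"
  where "cinner_complex x y = x * cnj y"

instance
proof
  fix x :: complex
  show "cinner x x = complex_of_real ((norm x)\<^sup>2)"
    unfolding cinner_complex_def by (rule complex_norm_square[symmetric])
qed (simp_all add: scaleC_complex_def cinner_complex_def algebra_simps scaleR_conv_of_real)

end

text \<open>The orthogonal sum \<open>H \<oplus> K\<close>; the library norm on pairs is already the Hilbert norm.\<close>

instantiation prod :: (complex_hilbert_space, complex_hilbert_space) complex_hilbert_space
begin

definition scaleC_prod :: "complex \<Rightarrow> 'a \<times> 'b \<Rightarrow> 'a \<times> 'b"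
  where "scaleC_prod c x = (c *\<^sub>C fst x, c *\<^sub>C snd x)"

definition cinner_prod :: "'a \<times> 'b \<Rightarrow> 'a \<times> 'b \<Rightarrow> complex"
  where "cinner_prod x y = cinner (fst x) (fst y) + cinner (snd x) (snd y)"

instance
proof
  fix x y :: "'a \<times> 'b"
  show "cinner y x = cnj (cinner x y)"
    by (simp add: cinner_prod_def cinner_commute[of "fst y" "fst x"]
        cinner_commute[of "snd y" "snd x"])
  show "cinner x x = complex_of_real ((norm x)\<^sup>2)"
    by (simp add: cinner_prod_def cinner_self norm_prod_def)
qed (simp_all add: scaleC_prod_def cinner_prod_def scaleC_add_right scaleC_add_left
      scaleC_scaleC scaleR_scaleC cinner_add_left cinner_scaleC_left prod_eq_iff algebra_simps)

end


section \<open>Bounded operators on a complex Hilbert space\<close>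

typedef (overloaded) 'a bop =
  "{f :: 'a::complex_hilbert_space \<Rightarrow> 'a. bounded_linear f \<and> (\<forall>c x. f (c *\<^sub>C x) = c *\<^sub>C f x)}"
  morphisms bop_apply Bop
proof
  show "(\<lambda>x. x) \<in> {f :: 'a \<Rightarrow> 'a. bounded_linear f \<and> (\<forall>c x. f (c *\<^sub>C x) = c *\<^sub>C f x)}"
    by (simp add: bounded_linear_ident)
qed

setup_lifting type_definition_bop

lemma bop_eqI: "(\<And>x. bop_apply S x = bop_apply T x) \<Longrightarrow> S = T"
  by (simp add: bop_apply_inject[symmetric] fun_eq_iff)

lemma bounded_linear_bop_apply: "bounded_linear (bop_apply T)"
  using bop_apply[of T] by simp

lemma bop_apply_scaleC: "bop_apply T (c *\<^sub>C x) = c *\<^sub>C bop_apply T x"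
  using bop_apply[of T] by simp

lemmas bop_apply_add = linear_add[OF bounded_linear.linear[OF bounded_linear_bop_apply]]

lemma scaleC_zero_right: "c *\<^sub>C (0::'a::complex_hilbert_space) = 0"
  using scaleC_add_right[of c 0 "0::'a"] by simp

lemma scaleC_minus_right: "c *\<^sub>C (- x) = - (c *\<^sub>C (x::'a::complex_hilbert_space))"
  using scaleC_add_right[of c "- x" x] by (simp add: scaleC_zero_right eq_neg_iff_add_eq_0)

lemma scaleC_diff_right: "c *\<^sub>C (x - y) = c *\<^sub>C x - c *\<^sub>C (y::'a::complex_hilbert_space)"
  using scaleC_add_right[of c x "- y"] by (simp add: scaleC_minus_right)

instantiation bop :: (complex_hilbert_space) "{ring, monoid_mult}"
begin

lift_definition zero_bop :: "'a bop" is "\<lambda>x. 0"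
  by (simp add: bounded_linear_zero scaleC_zero_right)

lift_definition one_bop :: "'a bop" is "\<lambda>x. x"
  by (simp add: bounded_linear_ident)

lift_definition plus_bop :: "'a bop \<Rightarrow> 'a bop \<Rightarrow> 'a bop" is "\<lambda>f g x. f x + g x"
  by (simp add: bounded_linear_add scaleC_add_right)

lift_definition uminus_bop :: "'a bop \<Rightarrow> 'a bop" is "\<lambda>f x. - f x"
  by (simp add: bounded_linear_minus scaleC_minus_right)

lift_definition minus_bop :: "'a bop \<Rightarrow> 'a bop \<Rightarrow> 'a bop" is "\<lambda>f g x. f x - g x"
  by (simp add: bounded_linear_sub scaleC_diff_right)

lift_definition times_bop :: "'a bop \<Rightarrow> 'a bop \<Rightarrow> 'a bop" is "\<lambda>f g x. f (g x)"
  by (simp add: bounded_linear_compose)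

instance
proof
  fix a b c :: "'a bop"
  show "a * (b + c) = a * b + a * c"
    by (rule bop_eqI) (simp add: times_bop.rep_eq plus_bop.rep_eq bop_apply_add)
qed (transfer; simp add: fun_eq_iff)+

end

lemma cinner_diff_left: "cinner (x - y) z = cinner x z - cinner y (z::'a::complex_hilbert_space)"
  using cinner_add_left[of "x - y" y z] by (simp add: algebra_simps)

lemma cinner_zero_left: "cinner 0 (x::'a::complex_hilbert_space) = 0"
  using cinner_add_left[of 0 0 x] by simp

lemma bop_eq_zero_if_form_zero:
  fixes T :: "'a::complex_hilbert_space bop"
  assumes form: "\<And>x. cinner (bop_apply T x) x = 0"
  shows "T = 0"
proof (rule bop_eqI)
  have sum_zero: "cinner (bop_apply T x) y + cinner (bop_apply T y) x = 0" for x y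
    using form[of "x + y"] form[of x] form[of y]
    by (simp add: bop_apply_add cinner_add_left cinner_add_right algebra_simps)
  have "cinner (bop_apply T x) y = 0" for x y
    using sum_zero[of x y] sum_zero[of "\<i> *\<^sub>C x" y]
    by (simp add: bop_apply_scaleC cinner_scaleC_left cinner_scaleC_right
        right_diff_distrib[symmetric])
  then have "cinner (bop_apply T x) (bop_apply T x) = 0" for x
    by blast
  then show "bop_apply T x = bop_apply 0 x" for x
    by (simp add: cinner_self zero_bop.rep_eq)
qed

text \<open>
  The Loewner order; \<open>0 \<le> T\<close> says that every \<open>\<langle>T x, x\<rangle>\<close> is a nonnegative real number.
\<close>

instantiation bop :: (complex_hilbert_space) order
begin

definition less_eq_bop :: "'a bop \<Rightarrow> 'a bop \<Rightarrow> bool"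
  where "S \<le> T \<longleftrightarrow> (\<forall>x. Im (cinner (bop_apply (T - S) x) x) = 0
                      \<and> 0 \<le> Re (cinner (bop_apply (T - S) x) x))"

definition less_bop :: "'a bop \<Rightarrow> 'a bop \<Rightarrow> bool"
  where "less_bop S T \<longleftrightarrow> S \<le> T \<and> \<not> T \<le> S"

instance
proof
  fix R S T :: "'a bop"
  show "S \<le> S"
    by (simp add: less_eq_bop_def zero_bop.rep_eq cinner_zero_left)
  show "R \<le> T" if "R \<le> S" "S \<le> T"
    unfolding less_eq_bop_def
  proof
    fix x
    show "Im (cinner (bop_apply (T - R) x) x) = 0 \<and> 0 \<le> Re (cinner (bop_apply (T - R) x) x)"
      using that[unfolded less_eq_bop_def, THEN spec[of _ x]]
      by (simp add: minus_bop.rep_eq cinner_diff_left)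
  qed
  show "S \<le> T \<Longrightarrow> T \<le> S \<Longrightarrow> S = T"
  proof -
    assume "S \<le> T" "T \<le> S"
    have "cinner (bop_apply (T - S) x) x = 0" for x
      using \<open>S \<le> T\<close>[unfolded less_eq_bop_def, THEN spec[of _ x]]
        \<open>T \<le> S\<close>[unfolded less_eq_bop_def, THEN spec[of _ x]]
      by (simp add: minus_bop.rep_eq cinner_diff_left complex_eq_iff)
    then show "S = T"
      using bop_eq_zero_if_form_zero[of "T - S"] by simp
  qed
qed (simp add: less_bop_def)

end

text \<open>Existence of the adjoint is the Riesz representation theorem.\<close>

definition adj :: "'a::complex_hilbert_space bop \<Rightarrow> 'a bop"
  where "adj T = (THE S. \<forall>x y. cinner (bop_apply T x) y = cinner x (bop_apply S y))"

text \<open>The positive square root of a positive operator.\<close>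

definition bop_sqrt :: "'a::complex_hilbert_space bop \<Rightarrow> 'a bop"
  where "bop_sqrt P = (THE S. 0 \<le> S \<and> S * S = P)"

definition bop_abs :: "'a::complex_hilbert_space bop \<Rightarrow> 'a bop"
  where "bop_abs T = bop_sqrt (adj T * T)"

definition contraction :: "'a::complex_hilbert_space bop \<Rightarrow> bool"
  where "contraction T \<longleftrightarrow> onorm (bop_apply T) \<le> 1"

definition bop_ker :: "'a::complex_hilbert_space bop \<Rightarrow> 'a set"
  where "bop_ker T = {x. bop_apply T x = 0}"

text \<open>A partial isometry is isometric on the orthogonal complement of its kernel.\<close>

definition partial_isometry :: "'a::complex_hilbert_space bop \<Rightarrow> bool"
  where "partial_isometry U \<longleftrightarrow>
    (\<forall>x. (\<forall>y\<in>bop_ker U. cinner x y = 0) \<longrightarrow> norm (bop_apply U x) = norm x)"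

text \<open>\<open>T = U |T|\<close> is the polar decomposition of \<open>T\<close>.\<close>

definition polar_decomposition :: "'a::complex_hilbert_space bop \<Rightarrow> 'a bop \<Rightarrow> bool"
  where "polar_decomposition T U \<longleftrightarrow>
    partial_isometry U \<and> bop_ker U = bop_ker (bop_abs T) \<and> T = U * bop_abs T"


section \<open>Operator matrices, 2-positive maps and the geometric mean\<close>

text \<open>The operator on \<open>H \<oplus> H\<close> with matrix rows \<open>A, B\<close> and \<open>C, D\<close>.\<close>

lift_definition block ::
  "'a::complex_hilbert_space bop \<Rightarrow> 'a bop \<Rightarrow> 'a bop \<Rightarrow> 'a bop \<Rightarrow> ('a \<times> 'a) bop"
  is "\<lambda>A B C D x. (A (fst x) + B (snd x), C (fst x) + D (snd x))"
proof -
  fix A B C D :: "'a \<Rightarrow> 'a"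
  assume A: "bounded_linear A \<and> (\<forall>c x. A (c *\<^sub>C x) = c *\<^sub>C A x)"
    and B: "bounded_linear B \<and> (\<forall>c x. B (c *\<^sub>C x) = c *\<^sub>C B x)"
    and C: "bounded_linear C \<and> (\<forall>c x. C (c *\<^sub>C x) = c *\<^sub>C C x)"
    and D: "bounded_linear D \<and> (\<forall>c x. D (c *\<^sub>C x) = c *\<^sub>C D x)"
  note fst = bounded_linear_compose[OF _ bounded_linear_fst]
    and snd = bounded_linear_compose[OF _ bounded_linear_snd]
  have "bounded_linear (\<lambda>x. (A (fst x) + B (snd x), C (fst x) + D (snd x)))"
    by (rule bounded_linear_Pair[OF bounded_linear_add[OF fst snd] bounded_linear_add[OF fst snd]])
      (simp_all add: A B C D)
  then show "bounded_linear (\<lambda>x. (A (fst x) + B (snd x), C (fst x) + D (snd x))) \<and>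
    (\<forall>c x. (A (fst (c *\<^sub>C x)) + B (snd (c *\<^sub>C x)), C (fst (c *\<^sub>C x)) + D (snd (c *\<^sub>C x))) =
      c *\<^sub>C (A (fst x) + B (snd x), C (fst x) + D (snd x)))"
    by (simp add: A B C D scaleC_prod_def scaleC_add_right)
qed

text \<open>Quantifying over blocks covers all operators on \<open>H \<oplus> H\<close>.\<close>

lemma block_surj:
  fixes T :: "('a::complex_hilbert_space \<times> 'a) bop"
  obtains A B C D where "T = block A B C D"
proof -
  have lin: "bounded_linear (\<lambda>x. fst (bop_apply T (x, 0)))"
    "bounded_linear (\<lambda>x. fst (bop_apply T (0, x)))"
    "bounded_linear (\<lambda>x. snd (bop_apply T (x, 0)))"
    "bounded_linear (\<lambda>x. snd (bop_apply T (0, x)))"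
    by (intro bounded_linear_compose[OF bounded_linear_fst]
        bounded_linear_compose[OF bounded_linear_snd]
        bounded_linear_compose[OF bounded_linear_bop_apply]
        bounded_linear_Pair bounded_linear_ident bounded_linear_zero)+
  have hom: "bop_apply T (c *\<^sub>C x, 0) = c *\<^sub>C bop_apply T (x, 0)"
    "bop_apply T (0, c *\<^sub>C x) = c *\<^sub>C bop_apply T (0, x)" for c x
    using bop_apply_scaleC[of T c "(x, 0)"] bop_apply_scaleC[of T c "(0, x)"]
    by (simp_all add: scaleC_prod_def scaleC_zero_right)
  have split: "bop_apply T x = bop_apply T (fst x, 0) + bop_apply T (0, snd x)" for x
    by (simp flip: bop_apply_add)
  have "T = block (Bop (\<lambda>x. fst (bop_apply T (x, 0)))) (Bop (\<lambda>x. fst (bop_apply T (0, x))))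
                  (Bop (\<lambda>x. snd (bop_apply T (x, 0)))) (Bop (\<lambda>x. snd (bop_apply T (0, x))))"
    by (rule bop_eqI, subst split)
      (simp add: block.rep_eq Bop_inverse lin hom scaleC_prod_def prod_eq_iff)
  then show thesis by (rule that)
qed

definition two_positive ::
  "('a::complex_hilbert_space bop \<Rightarrow> 'b::complex_hilbert_space bop) \<Rightarrow> bool"
  where "two_positive \<Phi> \<longleftrightarrow>
    (\<forall>A B C D. 0 \<le> block A B C D \<longrightarrow> 0 \<le> block (\<Phi> A) (\<Phi> B) (\<Phi> C) (\<Phi> D))"

definition star_map ::
  "('a::complex_hilbert_space bop \<Rightarrow> 'b::complex_hilbert_space bop) \<Rightarrow> bool"
  where "star_map \<Phi> \<longleftrightarrow> (\<forall>A. \<Phi> (adj A) = adj (\<Phi> A))"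

text \<open>The maximum in the Loewner order; it exists whenever \<open>A\<close> and \<open>B\<close> are positive.\<close>

definition geometric_mean ::
  "'a::complex_hilbert_space bop \<Rightarrow> 'a bop \<Rightarrow> 'a bop"  (infixl \<open>#\<^sub>g\<close> 67)
  where "A #\<^sub>g B = (GREATEST X. X = adj X \<and> 0 \<le> block A X X B)"

end

theory Submission imports Defs
begin

text \<open>
  Write \<open>P = \<Phi>(X\<^sup>* |A| X)\<close>, \<open>Q = \<Phi>(Y\<^sup>* |A\<^sup>*| Y)\<close> and \<open>T = \<Phi>(X\<^sup>* A\<^sup>* Y)\<close>. The block matrix with
  rows \<open>|A|, A\<^sup>*\<close> and \<open>A, |A\<^sup>*|\<close> is positive (\<open>abs_block_nonneg\<close>). Compressing it by
  \<open>diag(X, Y)\<close> and applying \<open>\<Phi>\<close> gives a positive matrix with rows \<open>P, T\<close> and \<open>T\<^sup>*, Q\<close>;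
  compressing that by \<open>diag(U, 1)\<close> turns the corners into \<open>U\<^sup>* T = |T|\<close>. Now let \<open>G\<close> be the
  geometric mean of the theorem. The matrix that defines it has rows
  \<open>U\<^sup>*(1 - P)U, G\<close> and \<open>G, 1 - Q\<close>, so adding the two matrices cancels \<open>P\<close> and \<open>Q\<close> and leaves the
  positive matrix with rows \<open>U\<^sup>*U, G + |T|\<close> and \<open>G + |T|, 1\<close>. Since \<open>U\<^sup>*U \<le> 1\<close>, evaluating its form at
  \<open>(x, -x)\<close> yields \<open>G + |T| \<le> 1\<close>.

  The argument uses only that the geometric mean is one of the operators over which the maximum is
  taken, but this requires the maximum to exist. For positive operators \<open>C\<close> and \<open>D\<close> of which \<open>C\<close> is
  bounded below and has the square root \<open>R\<close>, the maximum is \<open>R (R\<^sup>-\<^sup>1 D R\<^sup>-\<^sup>1)\<^sup>1\<^sup>/\<^sup>2 R\<close>; in general it is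
  the strong limit of the decreasing sequence of maxima for \<open>C + 1/(n+1)\<close> and \<open>D\<close>
  (\<open>has_greatest_admissible\<close>).

  Two facts do most of the work. Minimising a coercive quadratic functional on a closed subspace
  (\<open>coercive_form_represents\<close>) yields adjoints, inverses and the projection onto a kernel alike. And
  a self-adjoint \<open>Z\<close> with \<open>Z\<^sup>2 \<le> W\<^sup>2\<close>, \<open>W \<ge> 0\<close>, satisfies \<open>Z \<le> W\<close> (\<open>le_if_square_le\<close>); this gives
  the uniqueness of positive square roots, the positivity of the block matrix above, and the
  maximality of the geometric mean.
\<close>

section \<open>The underlying real inner product\<close>

text \<open>
  Replacing \<open>y\<close> by \<open>\<i> y\<close> recovers the complex inner product from its real part, so adjoints and the
  Loewner order can be expressed by the real inner product, where the arguments need no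
  conjugates.
\<close>

definition rinner :: "'a::complex_hilbert_space \<Rightarrow> 'a \<Rightarrow> real"
  where "rinner x y = Re (cinner x y)"

lemma rinner_commute: "rinner x y = rinner y x"
  unfolding rinner_def by (subst cinner_commute) simp

lemma rinner_self: "rinner x x = (norm x)\<^sup>2"
  by (simp add: rinner_def cinner_self)

lemma norm_add_square: "(norm (x + y))\<^sup>2 = (norm x)\<^sup>2 + 2 * rinner x y + (norm y)\<^sup>2"
  by (simp add: rinner_self[symmetric] rinner_def cinner_add_left cinner_add_right
      cinner_commute[of x y])

lemma rinner_scaleC_ii_right: "rinner x (\<i> *\<^sub>C y) = Im (cinner x y)"
  by (simp add: rinner_def cinner_scaleC_right)

lemma rinner_scaleC_right: "rinner x (c *\<^sub>C y) = rinner (cnj c *\<^sub>C x) y"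
  by (simp add: rinner_def cinner_scaleC_right cinner_scaleC_left)

lemma rinner_le_norm: "\<bar>rinner x y\<bar> \<le> norm x * norm y"
proof -
  have upper: "rinner x y \<le> norm x * norm y" for x y :: 'a
  proof -
    have "(norm (x + y))\<^sup>2 \<le> (norm x + norm y)\<^sup>2"
      by (simp add: norm_triangle_ineq power_mono)
    then show ?thesis
      by (simp add: norm_add_square power2_sum)
  qed
  have "rinner (- x) y = - rinner x y"
    using cinner_add_left[of "- x" x y] by (simp add: rinner_def cinner_zero_left complex_eq_iff)
  then show ?thesis
    using upper[of x y] upper[of "- x" y] by simp
qed

interpretation rinner: bounded_bilinear rinner
proof
  show "\<exists>K. \<forall>a b. norm (rinner a b) \<le> norm a * norm b * K"
    by (intro exI[of _ 1]) (simp add: rinner_le_norm)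
qed (simp_all add: rinner_def cinner_add_left cinner_add_right scaleR_scaleC
    cinner_scaleC_left cinner_scaleC_right)

lemmas bop_linear = bounded_linear.linear[OF bounded_linear_bop_apply]
lemmas bop_tendsto = bounded_linear.tendsto[OF bounded_linear_bop_apply]

lemmas bop_linear_simps = linear_add[OF bop_linear] linear_diff[OF bop_linear]
  linear_scale[OF bop_linear] linear_neg[OF bop_linear] linear_0[OF bop_linear]

lemma bop_bound: "\<exists>K>0. \<forall>x. norm (bop_apply T x) \<le> K * norm x"
  using bounded_linear.pos_bounded[OF bounded_linear_bop_apply[of T]] by (metis mult.commute)

lemmas rinner_simps = rinner.add_left rinner.add_right rinner.diff_left rinner.diff_right
  rinner.scaleR_left rinner.scaleR_right rinner.minus_left rinner.minus_right
  rinner.zero_left rinner.zero_right bop_linear_simps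

lemmas bop_rep = zero_bop.rep_eq one_bop.rep_eq plus_bop.rep_eq uminus_bop.rep_eq
  minus_bop.rep_eq times_bop.rep_eq

lemma norm_diff_square: "(norm (x - y))\<^sup>2 = (norm x)\<^sup>2 - 2 * rinner x y + (norm y)\<^sup>2"
  using norm_add_square[of x "- y"] by (simp add: rinner_simps)

lemma eq_if_rinner_eq:
  assumes "\<And>z. rinner z x = rinner z y"
  shows "x = y"
proof -
  have "rinner (x - y) (x - y) = 0"
    using assms[of "x - y"] by (simp add: rinner.diff_right)
  then show ?thesis by (simp add: rinner_self)
qed

lemma cinner_eq_if_rinner_eq:
  assumes "\<And>c. rinner x (c *\<^sub>C y) = rinner x' (c *\<^sub>C y')"
  shows "cinner x y = cinner x' y'"
  using assms[of 1] assms[of \<i>]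
  by (simp add: complex_eq_iff rinner_def cinner_scaleC_right)

text \<open>The discriminant of a nonnegative quadratic, covering the degenerate case of a linear one.\<close>

lemma quadratic_nonneg_imp:
  fixes a b c :: real
  assumes nonneg: "\<And>t. 0 \<le> a + 2 * b * t + c * t\<^sup>2" and c: "0 \<le> c"
  shows "b\<^sup>2 \<le> a * c"
proof (cases "c = 0")
  case True
  have "b = 0"
  proof (rule ccontr)
    assume "b \<noteq> 0"
    then show False
      using nonneg[of "- (a + 1) / (2 * b)"] True by (simp add: field_simps)
  qed
  then show ?thesis using True by simp
next
  case False
  then show ?thesis
    using nonneg[of "- b / c"] c by (simp add: field_simps power2_eq_square)
qed

section \<open>Coercive forms and the Riesz representation\<close>

text \<open>
  Dirichlet's principle: \<open>J x = \<langle>T x, x\<rangle> - 2 f x\<close> is bounded below on \<open>V\<close>, the parallelogram identity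
  and coercivity make every minimising sequence Cauchy, and at a minimiser all directional
  derivatives of \<open>J\<close> along \<open>V\<close> vanish. For \<open>T = 1\<close> and \<open>V\<close> the whole space this is the Riesz
  representation theorem; other \<open>T\<close> give the solvability of \<open>T u = y\<close>, and other \<open>V\<close> the orthogonal
  projection onto \<open>V\<close>.
\<close>

lemma coercive_form_represents:
  fixes T :: "'a::complex_hilbert_space bop"
  assumes V: "subspace V" "closed V"
    and sym: "\<And>x y. rinner (bop_apply T x) y = rinner x (bop_apply T y)"
    and e: "0 < e" and coercive: "\<And>x. e * (norm x)\<^sup>2 \<le> rinner (bop_apply T x) x"
    and f: "bounded_linear f"
  obtains u where "u \<in> V" and "\<And>v. v \<in> V \<Longrightarrow> f v = rinner (bop_apply T u) v"
proof -
  interpret f: bounded_linear f by (rule f)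
  define J where "J x = rinner (bop_apply T x) x - 2 * f x" for x
  obtain K where K: "0 < K" "\<And>x. norm (f x) \<le> norm x * K"
    using f.pos_bounded by blast
  have below: "- (K\<^sup>2 / e) \<le> J x" for x
  proof -
    have "0 \<le> (e * norm x - K)\<^sup>2" by simp
    then have "2 * K * (e * norm x) \<le> (e * norm x)\<^sup>2 + K\<^sup>2"
      by (simp add: power2_diff algebra_simps)
    then have "e * (2 * K * norm x) \<le> e * (e * (norm x)\<^sup>2 + K\<^sup>2 / e)"
      using e by (simp add: power2_eq_square algebra_simps)
    then have "2 * K * norm x \<le> e * (norm x)\<^sup>2 + K\<^sup>2 / e"
      using e by (simp only: mult_le_cancel_left_pos)
    with coercive[of x] K(2)[of x] show ?thesis
      by (simp add: J_def algebra_simps abs_le_iff)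
  qed
  define m where "m = Inf (J ` V)"
  have bdd: "bdd_below (J ` V)"
    using below by (intro bdd_belowI[of _ "- (K\<^sup>2 / e)"]) auto
  have ne: "J ` V \<noteq> {}"
    using subspace_0[OF V(1)] by auto
  have m_le: "m \<le> J x" if "x \<in> V" for x
    unfolding m_def using bdd that by (intro cInf_lower) auto
  have "\<exists>x\<in>V. J x < m + d" if "0 < d" for d
    using cInf_lessD[OF ne, of "m + d"] that by (auto simp: m_def)
  then have "\<forall>n. \<exists>x. x \<in> V \<and> J x < m + 1 / (real n + 1)"
    by (metis of_nat_0_le_iff add_nonneg_pos zero_less_one divide_pos_pos)
  then obtain s where s: "\<And>n. s n \<in> V" "\<And>n. J (s n) < m + 1 / (real n + 1)"
    by metis
  \<comment> \<open>the parallelogram identity for the form of \<open>T\<close>\<close>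
  have close: "e * (norm (x - y))\<^sup>2 \<le> 2 * (J x - m) + 2 * (J y - m)" if "x \<in> V" "y \<in> V" for x y
  proof -
    have "(1 / 2) *\<^sub>R (x + y) \<in> V"
      using V(1) that by (simp add: subspace_add subspace_scale)
    from m_le[OF this] have "4 * m \<le> rinner (bop_apply T (x + y)) (x + y) - 4 * f (x + y)"
      by (simp add: J_def rinner_simps f.scaleR f.add field_simps)
    moreover have "rinner (bop_apply T (x + y)) (x + y) + rinner (bop_apply T (x - y)) (x - y)
        = 2 * rinner (bop_apply T x) x + 2 * rinner (bop_apply T y) y"
      by (simp add: rinner_simps)
    ultimately show ?thesis
      using coercive[of "x - y"] by (simp add: J_def f.add)
  qed
  have "Cauchy s"
  proof (rule metric_CauchyI)
    fix d :: real assume d: "0 < d"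
    obtain N where N: "4 / (e * d\<^sup>2) < real N" using reals_Archimedean2 by blast
    have "dist (s i) (s j) < d" if "N \<le> i" "N \<le> j" for i j
    proof -
      define q where "q = 1 / (real N + 1)"
      have small: "J (s k) - m \<le> q" if "N \<le> k" for k
      proof -
        have "1 / (real k + 1) \<le> q"
          using that by (simp add: q_def frac_le)
        then show ?thesis using s(2)[of k] by linarith
      qed
      have "e * (norm (s i - s j))\<^sup>2 \<le> 4 * q"
        using close[OF s(1) s(1), of i j] small[OF that(1)] small[OF that(2)] by argo
      also have "\<dots> < e * d\<^sup>2"
        using N e d by (simp add: q_def field_simps add_strict_increasing)
      finally have "(norm (s i - s j))\<^sup>2 < d\<^sup>2" using e by simp
      then show ?thesis using d by (simp add: dist_norm power_less_imp_less_base)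
    qed
    then show "\<exists>M. \<forall>i\<ge>M. \<forall>j\<ge>M. dist (s i) (s j) < d" by blast
  qed
  then obtain u where u: "s \<longlonglongrightarrow> u"
    using Cauchy_convergent convergent_def by blast
  have uV: "u \<in> V"
    using closed_sequentially[OF V(2) _ u] s(1) by blast
  have "(\<lambda>n. J (s n)) \<longlonglongrightarrow> J u"
    unfolding J_def by (intro tendsto_intros rinner.tendsto bop_tendsto f.tendsto u)
  moreover have "(\<lambda>n. m + 1 / (real n + 1)) \<longlonglongrightarrow> m + 0"
    by (intro tendsto_add tendsto_const) (use lim_1_over_n[THEN LIMSEQ_Suc] in \<open>simp add: add.commute\<close>)
  ultimately have Ju: "J u \<le> m"
    using s(2) by (intro LIMSEQ_le[where Y = "\<lambda>n. m + 1 / (real n + 1)"]) (auto intro: less_imp_le)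
  show thesis
  proof (rule that[OF uV])
    fix v assume v: "v \<in> V"
    \<comment> \<open>\<open>2 b\<close> is the derivative of \<open>J\<close> at the minimiser in direction \<open>v\<close>\<close>
    define b where "b = rinner (bop_apply T u) v - f v"
    have "0 \<le> 0 + 2 * b * t + rinner (bop_apply T v) v * t\<^sup>2" for t
    proof -
      have "J u \<le> J (u + t *\<^sub>R v)"
        using Ju m_le[of "u + t *\<^sub>R v"] uV v V(1) by (simp add: subspace_add subspace_scale)
      then show ?thesis
        using sym[of v u] rinner_commute[of v "bop_apply T u"]
        by (simp add: J_def b_def rinner_simps f.add f.scaleR power2_eq_square algebra_simps)
    qed
    moreover have "0 \<le> rinner (bop_apply T v) v"
      using coercive[of v] e by (smt (verit) mult_nonneg_nonneg zero_le_power2)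
    ultimately have "b\<^sup>2 \<le> 0 * rinner (bop_apply T v) v"
      by (rule quadratic_nonneg_imp)
    then show "f v = rinner (bop_apply T u) v"
      by (simp add: b_def)
  qed
qed

section \<open>The adjoint\<close>

text \<open>
  Riesz gives \<open>S y\<close> for each \<open>y\<close>; the identity \<open>\<parallel>S y\<parallel>\<^sup>2 = \<langle>T (S y), y\<rangle>\<close> bounds \<open>S\<close> by the norm of \<open>T\<close>.
\<close>

lemma adjoint_exists:
  "\<exists>S. \<forall>x y. rinner (bop_apply T x) y = rinner x (bop_apply S y)"
proof -
  have "\<exists>u. \<forall>x. rinner (bop_apply T x) y = rinner u x" for y
  proof -
    have "bounded_linear (\<lambda>x. rinner (bop_apply T x) y)"
      by (intro bounded_linear_compose[OF rinner.bounded_linear_left] bounded_linear_bop_apply)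
    from coercive_form_represents[of UNIV 1 1, OF _ _ _ _ _ this]
    show ?thesis by (auto simp: one_bop.rep_eq rinner_self)
  qed
  then obtain S where S: "\<And>x y. rinner (bop_apply T x) y = rinner x (S y)"
    by (metis rinner_commute)
  obtain K where K: "0 < K" "\<And>x. norm (bop_apply T x) \<le> K * norm x"
    using bop_bound by blast
  have add: "S (x + y) = S x + S y" for x y
    by (rule eq_if_rinner_eq) (simp add: S[symmetric] rinner_simps)
  have scale: "S (c *\<^sub>C x) = c *\<^sub>C S x" for c x
    by (rule eq_if_rinner_eq)
      (simp add: S[symmetric] rinner_scaleC_right bop_apply_scaleC[symmetric])
  have "norm (S y) \<le> norm y * K" for y
  proof -
    have "norm (S y) * norm (S y) = rinner (bop_apply T (S y)) y"
      by (simp add: S rinner_self power2_eq_square)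
    also have "\<dots> \<le> norm (bop_apply T (S y)) * norm y"
      using rinner_le_norm[of "bop_apply T (S y)" y] by linarith
    also have "\<dots> \<le> norm (S y) * (norm y * K)"
      using mult_right_mono[OF K(2)[of "S y"] norm_ge_zero[of y]] by (simp add: ac_simps)
    finally show ?thesis
      using K(1) by (cases "S y = 0") simp_all
  qed
  then have "bounded_linear S"
    by (intro bounded_linear_intro[where K = K]) (simp_all add: add scale scaleR_scaleC)
  then have "bop_apply (Bop S) = S"
    by (simp add: Bop_inverse scale)
  with S show ?thesis by metis
qed

lemma rinner_adjoint_iff:
  "(\<forall>x y. cinner (bop_apply T x) y = cinner x (bop_apply S y)) \<longleftrightarrow>
   (\<forall>x y. rinner (bop_apply T x) y = rinner x (bop_apply S y))"
  by (auto simp: rinner_def bop_apply_scaleC[symmetric] intro!: cinner_eq_if_rinner_eq)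

lemma adj_eqI:
  assumes "\<And>x y. rinner (bop_apply T x) y = rinner x (bop_apply S y)"
  shows "adj T = S"
  unfolding adj_def rinner_adjoint_iff
proof (rule the_equality)
  fix R assume "\<forall>x y. rinner (bop_apply T x) y = rinner x (bop_apply R y)"
  with assms show "R = S"
    by (intro bop_eqI eq_if_rinner_eq) metis
qed (use assms in blast)

lemma rinner_adj: "rinner (bop_apply T x) y = rinner x (bop_apply (adj T) y)"
  using adjoint_exists[of T] adj_eqI by metis

lemma rinner_adj': "rinner (bop_apply (adj T) x) y = rinner x (bop_apply T y)"
  by (metis rinner_adj rinner_commute)

lemma adj_adj [simp]: "adj (adj T) = T"
  by (rule adj_eqI) (rule rinner_adj')

lemma adj_simps [simp]:
  "adj (S + T) = adj S + adj T" "adj (S - T) = adj S - adj T"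
  "adj (- T) = - adj T" "adj (S * T) = adj T * adj S" "adj 1 = 1" "adj 0 = 0"
  by (rule adj_eqI; simp add: bop_rep rinner_simps rinner_adj)+

text \<open>
  A form \<open>\<langle>D x, x\<rangle>\<close> that takes only real values is Hermitian by polarisation at \<open>x + \<i> y\<close>, so the
  condition on imaginary parts in the definition of the order amounts to self-adjointness.
\<close>

lemma bop_le_iff:
  "S \<le> T \<longleftrightarrow> adj (T - S) = T - S \<and> (\<forall>x. rinner (bop_apply S x) x \<le> rinner (bop_apply T x) x)"
  (is "?le \<longleftrightarrow> ?sa \<and> ?form")
proof
  assume le: ?le
  define D where "D = T - S"
  have re: "0 \<le> rinner (bop_apply D x) x" and im: "rinner (bop_apply D x) (\<i> *\<^sub>C x) = 0" for x
    using le by (auto simp: less_eq_bop_def D_def rinner_def rinner_scaleC_ii_right[unfolded rinner_def])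
  have "rinner (bop_apply D x) y = rinner x (bop_apply D y)" for x y
  proof -
    have "Im (cinner (bop_apply D (x + \<i> *\<^sub>C y)) (x + \<i> *\<^sub>C y)) = 0"
      "Im (cinner (bop_apply D x) x) = 0" "Im (cinner (bop_apply D y) y) = 0"
      using im by (simp_all only: rinner_scaleC_ii_right)
    then have "rinner (bop_apply D x) y = rinner (bop_apply D y) x"
      by (simp add: rinner_def bop_apply_add bop_apply_scaleC cinner_add_left cinner_add_right
          cinner_scaleC_left cinner_scaleC_right)
    then show ?thesis by (simp add: rinner_commute)
  qed
  then have "adj D = D" by (rule adj_eqI)
  then show "?sa \<and> ?form"
    using re by (simp add: D_def bop_rep rinner_simps)
next
  assume asm: "?sa \<and> ?form"
  define D where "D = T - S"
  have "rinner (bop_apply D x) (\<i> *\<^sub>C x) = 0" for x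
  proof -
    have "Re (cinner (bop_apply D x) (\<i> *\<^sub>C x)) = Re (cinner x (bop_apply D (\<i> *\<^sub>C x)))"
      using asm rinner_adj[of D] by (simp add: D_def rinner_def)
    then show ?thesis
      using cinner_commute[of x "bop_apply D x"]
      by (simp add: rinner_def bop_apply_scaleC cinner_scaleC_right)
  qed
  then show ?le
    using asm unfolding rinner_scaleC_ii_right
    by (auto simp: less_eq_bop_def D_def rinner_def bop_rep cinner_diff_left)
qed

lemma bop_nonneg_iff: "0 \<le> P \<longleftrightarrow> adj P = P \<and> (\<forall>x. 0 \<le> rinner (bop_apply P x) x)"
  by (simp add: bop_le_iff bop_rep rinner_simps)

lemma adj_nonneg: "0 \<le> P \<Longrightarrow> adj P = P"
  by (simp add: bop_nonneg_iff)

lemma rinner_nonneg: "0 \<le> P \<Longrightarrow> 0 \<le> rinner (bop_apply P x) x"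
  by (simp add: bop_nonneg_iff)

lemma rinner_selfadj: "adj T = T \<Longrightarrow> rinner (bop_apply T x) y = rinner x (bop_apply T y)"
  using rinner_adj[of T] by simp

lemma bop_le_iff_diff_nonneg: "S \<le> T \<longleftrightarrow> 0 \<le> T - (S :: 'a::complex_hilbert_space bop)"
  by (simp add: less_eq_bop_def)

lemma bop_add_nonneg: "0 \<le> S \<Longrightarrow> 0 \<le> T \<Longrightarrow> 0 \<le> S + (T :: 'a::complex_hilbert_space bop)"
  by (simp add: bop_nonneg_iff bop_rep rinner_simps)

lemma adj_sandwich_nonneg: "0 \<le> P \<Longrightarrow> 0 \<le> adj C * P * C"
  by (simp add: bop_nonneg_iff bop_rep rinner_adj' mult.assoc)

lemma adj_mult_self_nonneg: "0 \<le> adj C * C"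
  by (simp add: bop_nonneg_iff bop_rep rinner_adj' rinner_self)

lemma nonneg_form_Cauchy_Schwarz:
  assumes P: "0 \<le> P"
  shows "(rinner (bop_apply P x) y)\<^sup>2 \<le> rinner (bop_apply P x) x * rinner (bop_apply P y) y"
proof (rule quadratic_nonneg_imp)
  fix t
  have "rinner (bop_apply P y) x = rinner (bop_apply P x) y"
    using rinner_selfadj[OF adj_nonneg[OF P]] rinner_commute by metis
  then show "0 \<le> rinner (bop_apply P x) x + 2 * rinner (bop_apply P x) y * t
      + rinner (bop_apply P y) y * t\<^sup>2"
    using rinner_nonneg[OF P, of "x + t *\<^sub>R y"]
    by (simp add: rinner_simps power2_eq_square algebra_simps)
qed (rule rinner_nonneg[OF P])

text \<open>
  The Cauchy--Schwarz inequality of the form of \<open>P\<close> at \<open>x\<close> and \<open>P x\<close>. It lets convergence of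
  quadratic forms imply convergence of vectors.
\<close>

lemma nonneg_norm_square_le:
  assumes P: "0 \<le> P" and c: "0 \<le> c" and bound: "\<And>x. rinner (bop_apply P x) x \<le> c * (norm x)\<^sup>2"
  shows "(norm (bop_apply P x))\<^sup>2 \<le> c * rinner (bop_apply P x) x"
proof (cases "bop_apply P x = 0")
  case False
  define q where "q = (norm (bop_apply P x))\<^sup>2"
  have "q\<^sup>2 \<le> rinner (bop_apply P x) x * (c * q)"
    using nonneg_form_Cauchy_Schwarz[OF P, of x "bop_apply P x"] bound[of "bop_apply P x"]
      mult_left_mono[OF bound[of "bop_apply P x"] rinner_nonneg[OF P, of x]]
    by (simp add: q_def rinner_self)
  moreover have "0 < q" using False by (simp add: q_def)
  ultimately show ?thesis
    by (simp add: q_def[symmetric] power2_eq_square[of q] mult.commute[of c] flip: mult.assoc)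
qed (simp add: rinner_simps)

lemma nonneg_bound:
  fixes P :: "'a::complex_hilbert_space bop"
  assumes "0 \<le> P"
  obtains c where "0 < c" and "\<And>x. rinner (bop_apply P x) x \<le> c * (norm x)\<^sup>2"
proof -
  obtain c where c: "0 < c" "\<And>x. norm (bop_apply P x) \<le> c * norm x"
    using bop_bound[of P] by blast
  have "rinner (bop_apply P x) x \<le> c * (norm x)\<^sup>2" for x
    using rinner_le_norm[of "bop_apply P x" x] mult_right_mono[OF c(2)[of x] norm_ge_zero[of x]]
    by (simp add: power2_eq_square mult.assoc)
  with c(1) show thesis by (rule that)
qed

lift_definition real_op :: "real \<Rightarrow> 'a::complex_hilbert_space bop" is "\<lambda>c x. c *\<^sub>R x"
  by (simp add: bounded_linear_scaleR_right scaleR_scaleC scaleC_scaleC mult.commute)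

lemmas bop_rep_simps = bop_rep real_op.rep_eq

lemma adj_real_op [simp]: "adj (real_op c) = real_op c"
  by (rule adj_eqI) (simp add: bop_rep_simps rinner_simps)

lemma real_op_commute: "T * real_op c = real_op c * T"
  by (rule bop_eqI) (simp add: bop_rep_simps bop_linear_simps)

section \<open>Monotonicity of the square root\<close>

text \<open>
  Let \<open>m\<close> be the infimum of \<open>\<langle>D x, x\<rangle>\<close> over unit vectors. Then \<open>D - m \<ge> 0\<close>, and unit vectors at which
  its form is small are almost annihilated by it.
\<close>

lemma numerical_range_bottom_approximate_eigenvalue:
  assumes sa: "adj D = D" and neg: "\<not> 0 \<le> D"
  obtains m where "m < 0"
    and "\<And>d. 0 < d \<Longrightarrow> \<exists>x. norm x = 1 \<and> norm (bop_apply D x - m *\<^sub>R x) < d"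
proof -
  define F where "F x = rinner (bop_apply D x) x" for x
  define m where "m = Inf (F ` {x. norm x = 1})"
  have normalize: "F ((1 / norm x) *\<^sub>R x) = F x / (norm x)\<^sup>2" for x
    by (simp add: F_def rinner_simps power2_eq_square)
  obtain x0 where "F x0 < 0"
    using neg sa by (auto simp: bop_nonneg_iff F_def not_le)
  moreover from this have "x0 \<noteq> 0" by (auto simp: F_def rinner_simps)
  ultimately have x1: "norm ((1 / norm x0) *\<^sub>R x0) = 1" "F ((1 / norm x0) *\<^sub>R x0) < 0"
    by (simp_all add: normalize divide_neg_pos)
  obtain K where K: "0 < K" "\<And>x. norm (bop_apply D x) \<le> K * norm x"
    using bop_bound[of D] by blast
  have "- K \<le> F x" if "norm x = 1" for x
    using rinner_le_norm[of "bop_apply D x" x] K(2)[of x] that by (simp add: F_def)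
  then have bdd: "bdd_below (F ` {x. norm x = 1})"
    by (intro bdd_belowI[of _ "- K"]) auto
  have m_le: "m \<le> F x" if "norm x = 1" for x
    unfolding m_def using bdd that by (intro cInf_lower) auto
  have "m < 0" using m_le[OF x1(1)] x1(2) by linarith
  define E where "E = D - real_op m"
  have E_form: "rinner (bop_apply E x) x = F x - m * (norm x)\<^sup>2" for x
    by (simp add: E_def F_def bop_rep_simps rinner_simps rinner_self)
  have "0 \<le> F x - m * (norm x)\<^sup>2" for x
  proof (cases "x = 0")
    case False
    then show ?thesis
      using m_le[of "(1 / norm x) *\<^sub>R x"] by (simp add: normalize pos_le_divide_eq)
  qed (simp add: F_def rinner_simps)
  then have E: "0 \<le> E"
    using sa by (simp add: bop_nonneg_iff E_form) (simp add: E_def)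
  obtain c where c: "0 < c" and E_bound: "\<And>x. rinner (bop_apply E x) x \<le> c * (norm x)\<^sup>2"
    using nonneg_bound[OF E] by blast
  have "\<exists>x. norm x = 1 \<and> norm (bop_apply D x - m *\<^sub>R x) < d" if d: "0 < d" for d
  proof -
    have "\<exists>x. norm x = 1 \<and> F x < m + d\<^sup>2 / c"
    proof -
      have "\<exists>y\<in>F ` {x. norm x = 1}. y < m + d\<^sup>2 / c"
      proof (rule cInf_lessD)
        show "F ` {x. norm x = 1} \<noteq> {}" using x1(1) by blast
        show "Inf (F ` {x. norm x = 1}) < m + d\<^sup>2 / c"
          using d c by (simp add: m_def)
      qed
      then show ?thesis by auto
    qed
    then obtain x where x: "norm x = 1" "F x < m + d\<^sup>2 / c" by blast
    have "(norm (bop_apply E x))\<^sup>2 \<le> c * rinner (bop_apply E x) x"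
      using nonneg_norm_square_le[OF E _ E_bound] c by simp
    also have "\<dots> < c * (d\<^sup>2 / c)"
      using x c by (intro mult_strict_left_mono) (simp_all add: E_form)
    also have "\<dots> = d\<^sup>2" using c by simp
    finally have "norm (bop_apply E x) < d"
      using d by (simp add: power_less_imp_less_base)
    then show ?thesis
      using x(1) by (auto simp: E_def bop_rep_simps)
  qed
  with \<open>m < 0\<close> show thesis by (rule that)
qed

text \<open>
  Put \<open>D = W - Z\<close>; the hypothesis says \<open>\<parallel>D x\<parallel>\<^sup>2 \<le> 2 \<langle>W x, D x\<rangle>\<close> for all \<open>x\<close>. If \<open>D\<close> were not positive,
  an approximate eigenvector for some \<open>m < 0\<close> would make the left side close to \<open>m\<^sup>2\<close> and the right
  side close to \<open>2 m \<langle>W x, x\<rangle> \<le> 0\<close>.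
\<close>

lemma le_if_square_le:
  assumes Z: "adj Z = Z" and W: "0 \<le> W" and le: "Z * Z \<le> W * W"
  shows "Z \<le> W"
proof (rule ccontr)
  assume "\<not> Z \<le> W"
  define D where "D = W - Z"
  have "adj D = D" "\<not> 0 \<le> D"
    using \<open>\<not> Z \<le> W\<close> Z adj_nonneg[OF W] by (simp_all add: D_def bop_le_iff_diff_nonneg[of Z])
  then obtain m where m: "m < 0"
    and app: "\<And>d. 0 < d \<Longrightarrow> \<exists>x. norm x = 1 \<and> norm (bop_apply D x - m *\<^sub>R x) < d"
    by (rule numerical_range_bottom_approximate_eigenvalue) blast
  obtain K where K: "0 < K" "\<And>x. norm (bop_apply W x) \<le> K * norm x"
    using bop_bound[of W] by blast
  \<comment> \<open>The first bound gives \<open>\<parallel>D x\<parallel>\<^sup>2 > m\<^sup>2/4\<close>, the second keeps the error \<open>2 K d\<close> below \<open>m\<^sup>2/8\<close>.\<close>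
  define d where "d = min (- m / 2) (m\<^sup>2 / (16 * K))"
  have "0 < d" using m K(1) by (simp add: d_def)
  then obtain x where x: "norm x = 1" and xd: "norm (bop_apply D x - m *\<^sub>R x) < d"
    using app by blast
  have "- m - d < norm (bop_apply D x)"
    using norm_triangle_ineq2[of "m *\<^sub>R x" "bop_apply D x"] x xd m by (simp add: norm_minus_commute)
  moreover have "d \<le> - m / 2" by (simp add: d_def)
  ultimately have "- m / 2 < norm (bop_apply D x)" by linarith
  then have "(- m / 2)\<^sup>2 < (norm (bop_apply D x))\<^sup>2"
    using m by (intro power_strict_mono) simp_all
  also have "(norm (bop_apply D x))\<^sup>2 \<le> 2 * rinner (bop_apply W x) (bop_apply D x)"
  proof -
    have "rinner (bop_apply (Z * Z) x) x \<le> rinner (bop_apply (W * W) x) x"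
      using le by (simp add: bop_le_iff)
    then have "(norm (bop_apply Z x))\<^sup>2 \<le> (norm (bop_apply W x))\<^sup>2"
      by (simp add: bop_rep rinner_selfadj[OF Z] rinner_selfadj[OF adj_nonneg[OF W]]
          rinner_self[symmetric])
    moreover have "bop_apply Z x = bop_apply W x - bop_apply D x"
      by (simp add: D_def bop_rep)
    ultimately show ?thesis by (simp add: norm_diff_square)
  qed
  also have "\<dots> = 2 * m * rinner (bop_apply W x) x
      + 2 * rinner (bop_apply W x) (bop_apply D x - m *\<^sub>R x)"
    by (simp add: rinner_simps)
  also have "\<dots> \<le> 2 * (K * d)"
  proof -
    have "2 * m * rinner (bop_apply W x) x \<le> 0"
      using m rinner_nonneg[OF W] by (simp add: mult_nonpos_nonneg)
    moreover have "norm (bop_apply W x) * norm (bop_apply D x - m *\<^sub>R x) \<le> K * d"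
      using K(2)[of x] K(1) x xd by (intro mult_mono) simp_all
    ultimately show ?thesis
      using rinner_le_norm[of "bop_apply W x" "bop_apply D x - m *\<^sub>R x"] by linarith
  qed
  also have "\<dots> \<le> 2 * (K * (m\<^sup>2 / (16 * K)))"
    using K(1) by (intro mult_left_mono) (simp_all add: d_def)
  also have "\<dots> = m\<^sup>2 / 8" using K(1) by simp
  finally show False using m by (simp add: power_divide) 
qed

lemma nonneg_sqrt_unique:
  fixes S T :: "'a::complex_hilbert_space bop"
  assumes "0 \<le> S" "0 \<le> T" "S * S = T * T"
  shows "S = T"
  by (rule order_antisym; rule le_if_square_le) (simp_all add: assms adj_nonneg)

section \<open>Strong limits and square roots\<close>

lemma norm_scaleC: "norm (c *\<^sub>C x) = norm c * norm (x :: 'a::complex_hilbert_space)"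
proof -
  have "cinner (c *\<^sub>C x) (c *\<^sub>C x) = (c * cnj c) * cinner x x"
    by (simp add: cinner_scaleC_left cinner_scaleC_right)
  then have "complex_of_real ((norm (c *\<^sub>C x))\<^sup>2) = complex_of_real ((norm c * norm x)\<^sup>2)"
    by (simp only: cinner_self complex_norm_square[symmetric] power_mult_distrib of_real_mult)
  then show ?thesis
    unfolding of_real_eq_iff by (simp add: power2_eq_iff_nonneg)
qed

lemma bounded_linear_scaleC: "bounded_linear (\<lambda>x :: 'a::complex_hilbert_space. c *\<^sub>C x)"
  by (rule bounded_linear_intro[where K = "norm c"])
    (simp_all add: scaleC_add_right scaleR_scaleC scaleC_scaleC norm_scaleC mult.commute)

lemma strong_limit_exists:
  fixes T :: "nat \<Rightarrow> 'a::complex_hilbert_space bop"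
  assumes bound: "\<And>n x. norm (bop_apply (T n) x) \<le> K * norm x"
    and Cauchy: "\<And>x. Cauchy (\<lambda>n. bop_apply (T n) x)"
  obtains L where "\<And>x. (\<lambda>n. bop_apply (T n) x) \<longlonglongrightarrow> bop_apply L x"
proof -
  define L where "L x = lim (\<lambda>n. bop_apply (T n) x)" for x
  have L: "(\<lambda>n. bop_apply (T n) x) \<longlonglongrightarrow> L x" for x
    unfolding L_def using Cauchy by (intro convergent_LIMSEQ_iff[THEN iffD1] Cauchy_convergent)
  have add: "L (x + y) = L x + L y" for x y
  proof (rule LIMSEQ_unique[OF L])
    show "(\<lambda>n. bop_apply (T n) (x + y)) \<longlonglongrightarrow> L x + L y"
      unfolding bop_apply_add by (intro tendsto_add L)
  qed
  have scale: "L (c *\<^sub>C x) = c *\<^sub>C L x" for c x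
  proof (rule LIMSEQ_unique[OF L])
    show "(\<lambda>n. bop_apply (T n) (c *\<^sub>C x)) \<longlonglongrightarrow> c *\<^sub>C L x"
      unfolding bop_apply_scaleC by (intro bounded_linear.tendsto[OF bounded_linear_scaleC] L)
  qed
  have "norm (L x) \<le> norm x * K" for x
    by (rule LIMSEQ_le_const2[OF tendsto_norm[OF L[of x]]]) (use bound in \<open>simp add: mult.commute\<close>)
  then have "bounded_linear L"
    by (intro bounded_linear_intro[where K = K]) (simp_all add: add scale scaleR_scaleC)
  then have "bop_apply (Bop L) = L" by (simp add: Bop_inverse scale)
  with L show thesis by (intro that[of "Bop L"]) simp
qed

lemma strong_limit_selfadj:
  assumes L: "\<And>x. (\<lambda>n. bop_apply (T n) x) \<longlonglongrightarrow> bop_apply L x" and sa: "\<And>n. adj (T n) = T n"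
  shows "adj L = L"
proof (rule adj_eqI)
  fix x y
  have "(\<lambda>n. rinner (bop_apply (T n) x) y) \<longlonglongrightarrow> rinner (bop_apply L x) y"
    "(\<lambda>n. rinner x (bop_apply (T n) y)) \<longlonglongrightarrow> rinner x (bop_apply L y)"
    by (intro rinner.tendsto L tendsto_const)+
  then show "rinner (bop_apply L x) y = rinner x (bop_apply L y)"
    unfolding rinner_selfadj[OF sa] by (rule LIMSEQ_unique)
qed

text \<open>
  The equation \<open>(1 - Y)\<^sup>2 = 1 - B\<close> is equivalent to the fixed point equation \<open>Y = (B + Y\<^sup>2)/2\<close>.
\<close>

primrec sqrt_iter :: "'a::complex_hilbert_space bop \<Rightarrow> nat \<Rightarrow> 'a bop" where
  "sqrt_iter B 0 = 0"
| "sqrt_iter B (Suc n) = real_op (1 / 2) * (B + sqrt_iter B n * sqrt_iter B n)"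

text \<open>
  The same iteration for the number \<open>1\<close>. As the recursion has nonnegative coefficients, the numerical
  sequence dominates the operator sequence of every \<open>B\<close> with norm at most one; the dominated
  increments have a finite sum even when the norm of \<open>B\<close> is one.
\<close>

primrec sqrt_majorant :: "nat \<Rightarrow> real" where
  "sqrt_majorant 0 = 0"
| "sqrt_majorant (Suc n) = (1 + (sqrt_majorant n)\<^sup>2) / 2"

lemma sqrt_majorant_bounds: "0 \<le> sqrt_majorant n" "sqrt_majorant n \<le> 1"
proof (induction n)
  case (Suc n)
  { case 1 show ?case by simp }
  { case 2 show ?case using Suc power_le_one[of "sqrt_majorant n" 2] by simp }
qed simp_all

lemma sqrt_majorant_Suc_Suc:
  "sqrt_majorant (Suc (Suc n)) - sqrt_majorant (Suc n)
    = (sqrt_majorant (Suc n) - sqrt_majorant n) * (sqrt_majorant (Suc n) + sqrt_majorant n) / 2"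
  by (simp add: power2_eq_square field_simps)

lemma sqrt_majorant_incseq: "incseq sqrt_majorant"
proof (rule incseq_SucI)
  fix n show "sqrt_majorant n \<le> sqrt_majorant (Suc n)"
    using zero_le_power2[of "1 - sqrt_majorant n"] by (simp add: power2_diff)
qed

lemma sqrt_iter_commute:
  assumes "C * B = B * C"
  shows "C * sqrt_iter B n = sqrt_iter B n * C"
proof (induction n)
  case (Suc n)
  have "C * (sqrt_iter B n * sqrt_iter B n) = sqrt_iter B n * sqrt_iter B n * C"
    by (metis Suc mult.assoc)
  then have "C * (B + sqrt_iter B n * sqrt_iter B n) = (B + sqrt_iter B n * sqrt_iter B n) * C"
    by (simp add: distrib_left distrib_right assms)
  then have "real_op (1 / 2) * (C * (B + sqrt_iter B n * sqrt_iter B n))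
      = real_op (1 / 2) * ((B + sqrt_iter B n * sqrt_iter B n) * C)"
    by simp
  then show ?case
    by (simp only: sqrt_iter.simps(2) mult.assoc[symmetric] real_op_commute[of C])
qed simp

lemma sqrt_iter_selfadj: "adj B = B \<Longrightarrow> adj (sqrt_iter B n) = sqrt_iter B n"
  by (induction n) (simp_all add: real_op_commute)

lemma sqrt_iter_bound:
  assumes B: "\<And>x. norm (bop_apply B x) \<le> norm x"
  shows "norm (bop_apply (sqrt_iter B n) x) \<le> sqrt_majorant n * norm x"
proof (induction n arbitrary: x)
  case (Suc n)
  define Y where "Y = bop_apply (sqrt_iter B n)"
  have "norm (Y (Y x)) \<le> sqrt_majorant n * (sqrt_majorant n * norm x)"
    unfolding Y_def
    by (rule order_trans[OF Suc mult_left_mono[OF Suc sqrt_majorant_bounds(1)]])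
  then have "norm (bop_apply B x + Y (Y x)) \<le> (1 + (sqrt_majorant n)\<^sup>2) * norm x"
    using norm_triangle_ineq[of "bop_apply B x" "Y (Y x)"] B[of x]
    by (simp add: power2_eq_square algebra_simps)
  then show ?case
    by (simp add: bop_rep_simps Y_def)
qed (simp add: bop_rep)

text \<open>
  All iterates are polynomials in \<open>B\<close> and so commute, which allows the difference of consecutive
  squares to be factored as for numbers.
\<close>

lemma sqrt_iter_increment:
  assumes B: "\<And>x. norm (bop_apply B x) \<le> norm x"
  shows "norm (bop_apply (sqrt_iter B (Suc n)) x - bop_apply (sqrt_iter B n) x)
    \<le> (sqrt_majorant (Suc n) - sqrt_majorant n) * norm x"
proof (induction n arbitrary: x)
  case 0
  show ?case using B[of x] by (simp add: bop_rep_simps)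
next
  case (Suc n)
  define Y where "Y k = sqrt_iter B k" for k
  define y where "y k = sqrt_majorant k" for k
  define z where "z = bop_apply (Y (Suc n) + Y n) x"
  have comm: "Y (Suc n) * Y n = Y n * Y (Suc n)"
    unfolding Y_def by (intro sqrt_iter_commute sqrt_iter_commute[symmetric] refl)
  have "Y (Suc (Suc n)) - Y (Suc n)
      = real_op (1 / 2) * (Y (Suc n) * Y (Suc n) - Y n * Y n)"
    by (simp add: Y_def right_diff_distrib distrib_left)
  also have "Y (Suc n) * Y (Suc n) - Y n * Y n = (Y (Suc n) - Y n) * (Y (Suc n) + Y n)"
    using comm by (simp add: left_diff_distrib distrib_left)
  finally have "bop_apply (Y (Suc (Suc n)) - Y (Suc n)) x
      = bop_apply (real_op (1 / 2) * ((Y (Suc n) - Y n) * (Y (Suc n) + Y n))) x"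
    by simp
  then have "norm (bop_apply (Y (Suc (Suc n))) x - bop_apply (Y (Suc n)) x)
      = norm (bop_apply (Y (Suc n)) z - bop_apply (Y n) z) / 2"
    by (simp add: bop_rep_simps z_def)
  also have "\<dots> \<le> (y (Suc n) - y n) * norm z / 2"
    using Suc[of z] by (simp add: Y_def y_def)
  also have "\<dots> \<le> (y (Suc n) - y n) * ((y (Suc n) + y n) * norm x) / 2"
  proof (intro divide_right_mono mult_left_mono)
    show "norm z \<le> (y (Suc n) + y n) * norm x"
      using norm_triangle_ineq[of "bop_apply (Y (Suc n)) x" "bop_apply (Y n) x"]
        sqrt_iter_bound[OF B, of "Suc n" x] sqrt_iter_bound[OF B, of n x]
      unfolding z_def Y_def y_def plus_bop.rep_eq distrib_right by linarith
    show "0 \<le> y (Suc n) - y n"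
      using incseq_SucD[OF sqrt_majorant_incseq] by (simp add: y_def del: sqrt_majorant.simps)
  qed simp
  also have "\<dots> = (y (Suc (Suc n)) - y (Suc n)) * norm x"
    unfolding y_def sqrt_majorant_Suc_Suc by simp
  finally show ?case by (simp only: Y_def y_def)
qed

lemma Cauchy_if_increment_le:
  fixes X :: "nat \<Rightarrow> 'a::real_normed_vector" and r :: "nat \<Rightarrow> real"
  assumes inc: "\<And>n. norm (X (Suc n) - X n) \<le> r (Suc n) - r n" and r: "Cauchy r"
  shows "Cauchy X"
proof -
  have le: "dist (X m) (X n) \<le> dist (r m) (r n)" if "m \<le> n" for m n
  proof -
    have "norm (X n - X m) \<le> r n - r m"
      using that
    proof (induction n rule: dec_induct)
      case (step n)
      have "norm (X (Suc n) - X m) \<le> norm (X (Suc n) - X n) + norm (X n - X m)"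
        using norm_triangle_ineq[of "X (Suc n) - X n" "X n - X m"] by simp
      then show ?case using step inc[of n] by linarith
    qed simp
    then show ?thesis by (simp add: dist_norm norm_minus_commute)
  qed
  then have le': "dist (X m) (X n) \<le> dist (r m) (r n)" for m n
    by (metis dist_commute nle_le)
  show ?thesis
    unfolding Cauchy_def
  proof (intro allI impI)
    fix e :: real assume "0 < e"
    then obtain M where "\<forall>m\<ge>M. \<forall>n\<ge>M. dist (r m) (r n) < e"
      using r unfolding Cauchy_def by blast
    then show "\<exists>M. \<forall>m\<ge>M. \<forall>n\<ge>M. dist (X m) (X n) < e"
      using le' le_less_trans by blast
  qed
qed

lemma sqrt_one_minus_exists:
  assumes sa: "adj B = B" and B: "\<And>x. norm (bop_apply B x) \<le> norm x"
  shows "\<exists>S. 0 \<le> S \<and> S * S = 1 - B"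
proof -
  define Y where "Y = sqrt_iter B"
  have Y_bound: "norm (bop_apply (Y n) x) \<le> 1 * norm x" for n x
    using order_trans[OF sqrt_iter_bound[OF B] mult_right_mono[OF sqrt_majorant_bounds(2)]]
    by (simp add: Y_def)
  have "Cauchy sqrt_majorant"
    by (rule incseq_convergent[OF sqrt_majorant_incseq, of 1])
      (use sqrt_majorant_bounds(2) in \<open>auto intro: LIMSEQ_imp_Cauchy\<close>)
  have "Cauchy (\<lambda>n. bop_apply (Y n) x)" for x
  proof (rule Cauchy_if_increment_le)
    show "norm (bop_apply (Y (Suc n)) x - bop_apply (Y n) x)
        \<le> sqrt_majorant (Suc n) * norm x - sqrt_majorant n * norm x" for n
      using sqrt_iter_increment[OF B, of n x] unfolding Y_def left_diff_distrib .
    show "Cauchy (\<lambda>n. sqrt_majorant n * norm x)"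
      using \<open>Cauchy sqrt_majorant\<close> by (intro bounded_linear.Cauchy[OF bounded_linear_mult_left])
  qed
  then obtain L where L: "\<And>x. (\<lambda>n. bop_apply (Y n) x) \<longlonglongrightarrow> bop_apply L x"
    by (rule strong_limit_exists[OF Y_bound]) blast
  have L_bound: "norm (bop_apply L x) \<le> norm x" for x
    by (rule LIMSEQ_le_const2[OF tendsto_norm[OF L[of x]]]) (use Y_bound in simp)
  have saL: "adj L = L"
    using L by (rule strong_limit_selfadj) (simp add: Y_def sqrt_iter_selfadj sa)
  have fixpoint: "bop_apply L x = (1 / 2) *\<^sub>R (bop_apply B x + bop_apply L (bop_apply L x))" for x
  proof (rule LIMSEQ_unique)
    show "(\<lambda>n. bop_apply (Y (Suc n)) x) \<longlonglongrightarrow> bop_apply L x"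
      using L by (rule LIMSEQ_Suc)
    have "(\<lambda>n. bop_apply (Y n) (bop_apply (Y n) x - bop_apply L x)) \<longlonglongrightarrow> 0"
    proof (rule Lim_null_comparison)
      show "\<forall>\<^sub>F n in sequentially. norm (bop_apply (Y n) (bop_apply (Y n) x - bop_apply L x))
          \<le> norm (bop_apply (Y n) x - bop_apply L x)"
        using Y_bound by (intro always_eventually) simp
      show "(\<lambda>n. norm (bop_apply (Y n) x - bop_apply L x)) \<longlonglongrightarrow> 0"
        using L by (simp add: LIM_zero tendsto_norm_zero)
    qed
    from tendsto_add[OF this L[of "bop_apply L x"]]
    have "(\<lambda>n. bop_apply (Y n) (bop_apply (Y n) x)) \<longlonglongrightarrow> bop_apply L (bop_apply L x)"
      by (simp add: bop_linear_simps)
    then show "(\<lambda>n. bop_apply (Y (Suc n)) x)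
        \<longlonglongrightarrow> (1 / 2) *\<^sub>R (bop_apply B x + bop_apply L (bop_apply L x))"
      unfolding Y_def sqrt_iter.simps bop_rep_simps by (intro tendsto_scaleR tendsto_add tendsto_const)
  qed
  have "(1 - L) * (1 - L) = 1 - B"
  proof (rule bop_eqI)
    fix x
    have "2 *\<^sub>R bop_apply L x = bop_apply B x + bop_apply L (bop_apply L x)"
      using arg_cong[OF fixpoint[of x], of "scaleR 2"] by simp
    then show "bop_apply ((1 - L) * (1 - L)) x = bop_apply (1 - B) x"
      by (simp add: bop_rep_simps bop_linear_simps scaleR_2 algebra_simps)
  qed
  moreover have "0 \<le> 1 - L"
  proof -
    have "rinner (bop_apply L x) x \<le> norm x * norm x" for x
      using rinner_le_norm[of "bop_apply L x" x] mult_right_mono[OF L_bound[of x], of "norm x"]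
      by simp
    then show ?thesis
      by (simp add: bop_nonneg_iff saL bop_rep rinner_simps rinner_self power2_eq_square)
  qed
  ultimately show ?thesis by blast
qed

text \<open>Scaling \<open>P\<close> by an upper bound \<open>c\<close> of its form makes \<open>1 - P/c\<close> a positive contraction.\<close>

lemma sqrt_exists:
  fixes P :: "'a::complex_hilbert_space bop"
  assumes P: "0 \<le> P"
  shows "\<exists>S. 0 \<le> S \<and> S * S = P"
proof -
  obtain c where c: "0 < c" "\<And>x. rinner (bop_apply P x) x \<le> c * (norm x)\<^sup>2"
    using nonneg_bound[OF P] by blast
  define B where "B = 1 - real_op (1 / c) * P"
  have form: "rinner (bop_apply B x) x = (norm x)\<^sup>2 - rinner (bop_apply P x) x / c" for x
    by (simp add: B_def bop_rep_simps rinner_simps rinner_self)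
  have saB: "adj B = B"
    by (simp add: B_def adj_nonneg[OF P] real_op_commute)
  have "0 \<le> B"
    using c by (simp add: bop_nonneg_iff saB form pos_divide_le_eq mult.commute)
  have "norm (bop_apply B x) \<le> norm x" for x
  proof -
    have B_le: "rinner (bop_apply B x) x \<le> 1 * (norm x)\<^sup>2" for x
      using rinner_nonneg[OF P, of x] c(1) by (simp add: form)
    have "(norm (bop_apply B x))\<^sup>2 \<le> 1 * rinner (bop_apply B x) x"
      by (rule nonneg_norm_square_le[OF \<open>0 \<le> B\<close> _ B_le]) simp
    then have "(norm (bop_apply B x))\<^sup>2 \<le> (norm x)\<^sup>2"
      using B_le[of x] by linarith
    then show ?thesis by (rule power2_le_imp_le) simp
  qed
  with saB obtain S where S: "0 \<le> S" "S * S = 1 - B"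
    using sqrt_one_minus_exists[of B] by blast
  define R where "R = real_op (sqrt c) * S"
  have "R * R = P"
  proof (rule bop_eqI)
    fix x
    have "bop_apply (S * S) x = bop_apply (1 - B) x" by (simp only: S(2))
    then show "bop_apply (R * R) x = bop_apply P x"
      using c(1) by (simp add: R_def B_def bop_rep_simps bop_linear_simps)
  qed
  moreover have "adj R = R"
    by (simp add: R_def adj_nonneg[OF S(1)] real_op_commute)
  then have "0 \<le> R"
    using rinner_nonneg[OF S(1)] c(1)
    by (simp add: bop_nonneg_iff) (simp add: R_def bop_rep_simps rinner_simps)
  ultimately show ?thesis by blast
qed

lemma bop_sqrt:
  fixes P :: "'a::complex_hilbert_space bop"
  assumes "0 \<le> P"
  shows bop_sqrt_nonneg: "0 \<le> bop_sqrt P" and bop_sqrt_square: "bop_sqrt P * bop_sqrt P = P"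
proof -
  have "\<exists>!S. 0 \<le> S \<and> S * S = P"
    using sqrt_exists[OF assms] nonneg_sqrt_unique by metis
  from theI'[OF this] show "0 \<le> bop_sqrt P" "bop_sqrt P * bop_sqrt P = P"
    by (simp_all add: bop_sqrt_def)
qed

lemma bop_abs_nonneg: "0 \<le> bop_abs T" and bop_abs_square: "bop_abs T * bop_abs T = adj T * T"
  by (simp_all add: bop_abs_def bop_sqrt_nonneg bop_sqrt_square adj_mult_self_nonneg)

section \<open>Operator matrices\<close>

lemma rinner_prod: "rinner x y = rinner (fst x) (fst y) + rinner (snd x) (snd y)"
  by (simp add: rinner_def cinner_prod_def)

lemma adj_block [simp]: "adj (block A B C D) = block (adj A) (adj C) (adj B) (adj D)"
  by (rule adj_eqI) (simp add: rinner_prod block.rep_eq rinner_simps rinner_adj)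

lemma block_mult:
  "block A B C D * block E F G H
    = block (A * E + B * G) (A * F + B * H) (C * E + D * G) (C * F + D * H)"
  by (rule bop_eqI) (simp add: block.rep_eq bop_rep bop_linear_simps)

lemma block_add: "block A B C D + block E F G H = block (A + E) (B + F) (C + G) (D + H)"
  by (rule bop_eqI) (simp add: block.rep_eq bop_rep)

lemma block_inject: "block A B C D = block E F G H \<longleftrightarrow> A = E \<and> B = F \<and> C = G \<and> D = H"
proof
  assume eq: "block A B C D = block E F G H"
  have "bop_apply (block A B C D) (x, y) = bop_apply (block E F G H) (x, y)" for x y
    by (simp only: eq)
  then have eq: "bop_apply A x + bop_apply B y = bop_apply E x + bop_apply F y"
    "bop_apply C x + bop_apply D y = bop_apply G x + bop_apply H y" for x y
    by (simp_all add: block.rep_eq)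
  have "bop_apply A x = bop_apply E x" "bop_apply B x = bop_apply F x"
    "bop_apply C x = bop_apply G x" "bop_apply D x = bop_apply H x" for x
    using eq[of x 0] eq[of 0 x] by (simp_all add: bop_linear_simps)
  then show "A = E \<and> B = F \<and> C = G \<and> D = H"
    by (simp add: bop_eqI)
qed simp

lemma block_form:
  "rinner (bop_apply (block A B C D) (x, y)) (x, y)
    = rinner (bop_apply A x) x + rinner (bop_apply B y) x
      + rinner (bop_apply C x) y + rinner (bop_apply D y) y"
  by (simp add: rinner_prod block.rep_eq rinner_simps)

lemma block_diag_nonneg_iff: "0 \<le> block A 0 0 D \<longleftrightarrow> 0 \<le> A \<and> 0 \<le> D"
proof
  assume nonneg: "0 \<le> block A 0 0 D"
  have "0 \<le> rinner (bop_apply A x) x" "0 \<le> rinner (bop_apply D x) x" for x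
    using rinner_nonneg[OF nonneg, of "(x, 0)"] rinner_nonneg[OF nonneg, of "(0, x)"]
    by (simp_all add: block_form rinner_simps bop_rep)
  then show "0 \<le> A \<and> 0 \<le> D"
    using adj_nonneg[OF nonneg] by (simp add: bop_nonneg_iff block_inject)
next
  assume "0 \<le> A \<and> 0 \<le> D"
  then have "adj A = A" "adj D = D" "0 \<le> rinner (bop_apply A x) x"
      "0 \<le> rinner (bop_apply D x) x" for x
    by (simp_all add: bop_nonneg_iff)
  then show "0 \<le> block A 0 0 D"
    by (simp add: bop_nonneg_iff split_paired_all block_form bop_rep rinner_simps)
qed

lemma block_corners_nonneg:
  assumes "0 \<le> block A B C D"
  shows "0 \<le> A" "0 \<le> D"
proof -
  have "0 \<le> adj (block 1 0 0 0) * block A B C D * block 1 0 0 0"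
    "0 \<le> adj (block 0 0 0 1) * block A B C D * block 0 0 0 1"
    using assms by (rule adj_sandwich_nonneg)+
  then show "0 \<le> A" "0 \<le> D"
    by (simp_all add: block_mult block_diag_nonneg_iff)
qed

text \<open>
  The self-adjoint matrix \<open>Z\<close> with rows \<open>0, -A\<^sup>*\<close> and \<open>-A, 0\<close> has the same square
  \<open>diag(A\<^sup>*A, AA\<^sup>*)\<close> as \<open>W = diag(|A|, |A\<^sup>*|)\<close>, hence \<open>Z \<le> W\<close>.
\<close>

lemma abs_block_nonneg: "0 \<le> block (bop_abs A) (adj A) A (bop_abs (adj A))"
proof -
  define W where "W = block (bop_abs A) 0 0 (bop_abs (adj A))"
  define Z where "Z = - block 0 (adj A) A 0"
  have "Z \<le> W"
  proof (rule le_if_square_le)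
    show "adj Z = Z" by (simp add: Z_def)
    show "0 \<le> W" by (simp add: W_def block_diag_nonneg_iff bop_abs_nonneg)
    have "Z * Z = W * W"
      by (simp add: Z_def W_def block_mult bop_abs_square)
    then show "Z * Z \<le> W * W" by simp
  qed
  then have "0 \<le> W - Z" by (simp add: bop_le_iff_diff_nonneg[symmetric])
  then show ?thesis by (simp add: W_def Z_def block_add)
qed

lemma nonneg_block_one_imp_le:
  assumes "0 \<le> block C S S 1" "C \<le> 1"
  shows "S \<le> 1"
proof -
  have sa: "adj S = S"
    using adj_nonneg[OF assms(1)] by (simp add: block_inject)
  have "rinner (bop_apply S x) x \<le> (norm x)\<^sup>2" for x
  proof -
    have "rinner (bop_apply C x) x \<le> (norm x)\<^sup>2"
      using assms(2) by (simp add: bop_le_iff bop_rep rinner_self)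
    then show ?thesis
      using rinner_nonneg[OF assms(1), of "(x, - x)"]
      by (simp add: block_form rinner_simps bop_rep rinner_self)
  qed
  then show ?thesis by (simp add: bop_le_iff sa bop_rep rinner_self)
qed

section \<open>Existence of the geometric mean\<close>

text \<open>Surjectivity is the solvability of \<open>T u = y\<close>, the bound on the inverse is coercivity.\<close>

lemma coercive_inverse:
  fixes T :: "'a::complex_hilbert_space bop"
  assumes sa: "adj T = T" and e: "0 < e"
    and coercive: "\<And>x. e * (norm x)\<^sup>2 \<le> rinner (bop_apply T x) x"
  obtains M where "adj M = M" "T * M = 1" "M * T = 1"
proof -
  have "\<exists>u. bop_apply T u = y" for y
  proof -
    obtain u where u: "\<And>v. v \<in> UNIV \<Longrightarrow> rinner y v = rinner (bop_apply T u) v"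
      by (rule coercive_form_represents[OF subspace_UNIV closed_UNIV rinner_selfadj[OF sa] e coercive
            rinner.bounded_linear_right[of y]]) (rule that)
    have "bop_apply T u = y"
    proof (rule eq_if_rinner_eq)
      show "rinner v (bop_apply T u) = rinner v y" for v
        using u[OF UNIV_I, of v] rinner_commute[of v y] rinner_commute[of v "bop_apply T u"]
        by linarith
    qed
    then show ?thesis by blast
  qed
  then obtain M where M: "\<And>y. bop_apply T (M y) = y" by metis
  have lower: "e * norm x \<le> norm (bop_apply T x)" for x
  proof (cases "x = 0")
    case False
    have "(e * norm x) * norm x \<le> norm (bop_apply T x) * norm x"
      using coercive[of x] rinner_le_norm[of "bop_apply T x" x]
      by (simp add: power2_eq_square)
    then show ?thesis using False by simp
  qed simp
  have inj: "x = y" if "bop_apply T x = bop_apply T y" for x y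
    using lower[of "x - y"] that e by (simp add: bop_linear_simps mult_le_0_iff)
  have add: "M (x + y) = M x + M y" for x y
    by (rule inj) (simp add: M bop_linear_simps)
  have scale: "M (c *\<^sub>C x) = c *\<^sub>C M x" for c x
    by (rule inj) (simp add: M bop_apply_scaleC)
  have "norm (M x) \<le> norm x * (1 / e)" for x
    using lower[of "M x"] e by (simp add: M field_simps)
  then have "bounded_linear M"
    by (intro bounded_linear_intro[where K = "1 / e"]) (simp_all add: add scale scaleR_scaleC)
  then have rep: "bop_apply (Bop M) = M" by (simp add: Bop_inverse scale)
  show thesis
  proof (rule that)
    show "T * Bop M = 1" by (rule bop_eqI) (simp add: bop_rep rep M)
    show "Bop M * T = 1" by (rule bop_eqI, rule inj) (simp add: bop_rep rep M)
    show "adj (Bop M) = Bop M"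
    proof (rule adj_eqI)
      fix x y
      show "rinner (bop_apply (Bop M) x) y = rinner x (bop_apply (Bop M) y)"
        using rinner_selfadj[OF sa, of "M x" "M y"] by (simp add: rep M)
    qed
  qed
qed

definition admissible :: "'a::complex_hilbert_space bop \<Rightarrow> 'a bop \<Rightarrow> 'a bop \<Rightarrow> bool"
  where "admissible A B X \<longleftrightarrow> adj X = X \<and> 0 \<le> block A X X B"

text \<open>
  Compressing by the inverse \<open>N\<close> of the square root \<open>R\<close> of \<open>A\<close> reduces to the case where the upper
  left entry is \<open>1\<close> and the lower right entry is \<open>C\<^sup>2\<close> with \<open>C = (N B N)\<^sup>1\<^sup>/\<^sup>2\<close>. There \<open>Y\<close> is admissible
  exactly if \<open>Y\<^sup>2 \<le> C\<^sup>2\<close>, and the greatest such \<open>Y\<close> is \<open>C\<close>.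
\<close>

lemma coercive_has_greatest_admissible:
  assumes A: "0 \<le> A" and e: "0 < e"
    and coercive: "\<And>x. e * (norm x)\<^sup>2 \<le> rinner (bop_apply A x) x" and B: "0 \<le> B"
  obtains G where "admissible A B G" and "\<And>X. admissible A B X \<Longrightarrow> X \<le> G"
proof -
  obtain M where M: "adj M = M" "A * M = 1" "M * A = 1"
    using coercive_inverse[OF adj_nonneg[OF A] e coercive] by blast
  define R where "R = bop_sqrt A"
  have R: "adj R = R" "R * R = A"
    using A by (simp_all add: R_def bop_sqrt_square adj_nonneg bop_sqrt_nonneg)
  define N where "N = R * M"
  have RN: "R * N = 1"
    using M(2) by (simp add: N_def R(2) flip: mult.assoc)
  have "M * R * (R * N) = M * (R * R) * N" by (simp only: mult.assoc)
  then have N: "N = M * R" by (simp add: RN R(2) M(3))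
  have saN: "adj N = N"
    using arg_cong[OF N, of adj] by (simp add: N_def R(1) M(1))
  have NR: "N * R = 1" using M(3) by (simp add: N R(2) mult.assoc)
  have NRx: "N * (R * x) = x" and RNx: "R * (N * x) = x" for x
    by (simp_all add: NR RN flip: mult.assoc)
  define C where "C = bop_sqrt (N * B * N)"
  have "0 \<le> N * B * N" using adj_sandwich_nonneg[OF B, of N] by (simp add: saN)
  then have C: "0 \<le> C" "C * C = N * B * N"
    by (simp_all add: C_def bop_sqrt_nonneg bop_sqrt_square)
  have saC: "adj C = C" by (rule adj_nonneg[OF C(1)])
  define G where "G = R * C * R"
  show thesis
  proof (rule that)
    have "R * C * (C * R) = R * (C * C) * R" by (simp add: mult.assoc)
    also have "\<dots> = B" by (simp add: C(2) mult.assoc NR RNx)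
    finally have "adj (block R (C * R) 0 0) * block R (C * R) 0 0 = block A G G B"
      by (simp add: block_mult R saC G_def mult.assoc)
    then show "admissible A B G"
      using adj_mult_self_nonneg[of "block R (C * R) 0 0"]
      by (simp add: admissible_def G_def R(1) saC mult.assoc)
  next
    fix X assume X: "admissible A B X"
    then have saX: "adj X = X" by (simp add: admissible_def)
    define Y where "Y = N * X * N"
    have saY: "adj Y = Y" by (simp add: Y_def saN saX mult.assoc)
    have "0 \<le> adj (block N 0 0 N) * block A X X B * block N 0 0 N"
      using X by (intro adj_sandwich_nonneg) (simp add: admissible_def)
    also have "\<dots> = block 1 Y Y (C * C)"
      by (simp add: block_mult saN Y_def C(2) mult.assoc NRx RN flip: R(2))
    \<comment> \<open>evaluating the form at the vectors \<open>(-Y v, v)\<close> leaves the Schur complement\<close>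
    finally have "0 \<le> adj (block 0 (- Y) 0 1) * block 1 Y Y (C * C) * block 0 (- Y) 0 1"
      by (rule adj_sandwich_nonneg)
    then have "0 \<le> C * C - Y * Y"
      by (simp add: block_mult saY block_diag_nonneg_iff)
    then have "Y \<le> C"
      by (intro le_if_square_le[OF saY C(1)]) (simp add: bop_le_iff_diff_nonneg[symmetric])
    then have "0 \<le> adj R * (C - Y) * R"
      by (intro adj_sandwich_nonneg) (simp add: bop_le_iff_diff_nonneg[symmetric])
    also have "\<dots> = G - X"
      by (simp add: R(1) G_def Y_def left_diff_distrib right_diff_distrib mult.assoc NR RNx)
    finally show "X \<le> G" by (simp add: bop_le_iff_diff_nonneg[symmetric])
  qed
qed

text \<open>
  The forms \<open>\<langle>G n x, x\<rangle>\<close> decrease to a limit, and by \<open>nonneg_norm_square_le\<close> the differences of the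
  forms control those of the vectors \<open>G n x\<close>.
\<close>

lemma decreasing_strong_limit:
  fixes G :: "nat \<Rightarrow> 'a::complex_hilbert_space bop"
  assumes nonneg: "\<And>n. 0 \<le> G n" and dec: "\<And>n. G (Suc n) \<le> G n"
  obtains L where "\<And>x. (\<lambda>n. bop_apply (G n) x) \<longlonglongrightarrow> bop_apply L x"
proof -
  have decseq: "G n \<le> G m" if "m \<le> n" for m n
    using that by (rule lift_Suc_antimono_le[of G, OF dec])
  obtain c where c: "0 < c" "\<And>x. rinner (bop_apply (G 0) x) x \<le> c * (norm x)\<^sup>2"
    using nonneg_bound[OF nonneg[of 0]] by blast
  have form_le: "rinner (bop_apply (G n) x) x \<le> c * (norm x)\<^sup>2" for n x
  proof -
    have "rinner (bop_apply (G n) x) x \<le> rinner (bop_apply (G 0) x) x"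
      using decseq[of 0 n] by (simp add: bop_le_iff)
    with c(2)[of x] show ?thesis by linarith
  qed
  have bound: "norm (bop_apply (G n) x) \<le> c * norm x" for n x
  proof -
    have "(norm (bop_apply (G n) x))\<^sup>2 \<le> c * rinner (bop_apply (G n) x) x"
      using c(1) by (intro nonneg_norm_square_le nonneg form_le) simp
    also have "\<dots> \<le> c * (c * (norm x)\<^sup>2)"
      using c(1) by (intro mult_left_mono form_le) simp
    also have "\<dots> = (c * norm x)\<^sup>2" by (simp add: power2_eq_square)
    finally show ?thesis by (rule power2_le_imp_le) (use c(1) in simp)
  qed
  have "Cauchy (\<lambda>n. bop_apply (G n) x)" for x
  proof -
    define a where "a n = rinner (bop_apply (G n) x) x" for n
    have diff: "(norm (bop_apply (G m) x - bop_apply (G n) x))\<^sup>2 \<le> c * \<bar>a m - a n\<bar>"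
      if "m \<le> n" for m n
    proof -
      have D: "0 \<le> G m - G n"
        using decseq[OF that] by (simp only: bop_le_iff_diff_nonneg[of "G n"])
      have D_form: "rinner (bop_apply (G m - G n) y) y
          = rinner (bop_apply (G m) y) y - rinner (bop_apply (G n) y) y" for y
        by (simp add: bop_rep rinner_simps)
      have "rinner (bop_apply (G m - G n) y) y \<le> c * (norm y)\<^sup>2" for y
        using form_le[of m y] rinner_nonneg[OF nonneg, of n y] unfolding D_form by linarith
      then have "(norm (bop_apply (G m - G n) x))\<^sup>2 \<le> c * rinner (bop_apply (G m - G n) x) x"
        using c(1) by (intro nonneg_norm_square_le D) simp_all
      also have "\<dots> \<le> c * \<bar>a m - a n\<bar>"
        using c(1) unfolding D_form by (simp add: a_def)
      finally show ?thesis by (simp add: bop_rep)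
    qed
    have diff': "(norm (bop_apply (G m) x - bop_apply (G n) x))\<^sup>2 \<le> c * \<bar>a m - a n\<bar>" for m n
      using diff[of m n] diff[of n m] by (cases "m \<le> n") (simp_all add: norm_minus_commute abs_minus_commute)
    have "decseq a"
      using dec by (intro decseq_SucI) (simp add: a_def bop_le_iff)
    moreover have "\<forall>n. 0 \<le> a n" by (simp add: a_def rinner_nonneg nonneg)
    ultimately have "Cauchy a"
      by (rule decseq_convergent[of a 0]) (rule LIMSEQ_imp_Cauchy)
    show ?thesis
      unfolding Cauchy_def
    proof (intro allI impI)
      fix e :: real assume e: "0 < e"
      then have "0 < e\<^sup>2 / c" using c(1) by simp
      then obtain k where k: "\<forall>m\<ge>k. \<forall>n\<ge>k. dist (a m) (a n) < e\<^sup>2 / c"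
        using \<open>Cauchy a\<close> unfolding Cauchy_def by blast
      have "dist (bop_apply (G m) x) (bop_apply (G n) x) < e" if "k \<le> m" "k \<le> n" for m n
      proof -
        have "\<bar>a m - a n\<bar> < e\<^sup>2 / c" using k that by (simp add: dist_real_def)
        then have "c * \<bar>a m - a n\<bar> < e\<^sup>2"
          using c(1) by (simp add: pos_less_divide_eq mult.commute)
        with diff'[of m n] have "(norm (bop_apply (G m) x - bop_apply (G n) x))\<^sup>2 < e\<^sup>2"
          by linarith
        then show ?thesis using e by (simp add: dist_norm power_less_imp_less_base)
      qed
      then show "\<exists>M. \<forall>m\<ge>M. \<forall>n\<ge>M. dist (bop_apply (G m) x) (bop_apply (G n) x) < e"
        by blast
    qed
  qed
  then obtain L where "\<And>x. (\<lambda>n. bop_apply (G n) x) \<longlonglongrightarrow> bop_apply L x"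
    by (rule strong_limit_exists[OF bound]) blast
  then show thesis by (rule that)
qed

text \<open>
  Admissibility is monotone in \<open>A\<close>. Hence the maxima \<open>G n\<close> for \<open>A + 1/(n+1)\<close> decrease and dominate
  every operator that is admissible for \<open>A\<close>; their limit still does, and positivity of the block
  matrices survives the limit.
\<close>

lemma has_greatest_admissible:
  assumes A: "0 \<le> A" and B: "0 \<le> B"
  obtains G where "admissible A B G" and "\<And>X. admissible A B X \<Longrightarrow> X \<le> G"
proof -
  define e where "e n = 1 / (real n + 1)" for n
  define A' where "A' n = A + real_op (e n)" for n
  have e: "0 < e n" "e (Suc n) \<le> e n" for n
    by (simp_all add: e_def frac_le)
  have "e \<longlonglongrightarrow> 0"
    unfolding e_def using lim_1_over_n[THEN LIMSEQ_Suc] by (simp add: add.commute)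
  have real_op_nonneg: "0 \<le> real_op c" if "0 \<le> c" for c
    using that by (simp add: bop_nonneg_iff bop_rep_simps rinner_simps rinner_self)
  have A': "0 \<le> A' n" for n
    using A e(1)[of n] by (simp add: A'_def bop_add_nonneg real_op_nonneg)
  have "e n * (norm x)\<^sup>2 \<le> rinner (bop_apply (A' n) x) x" for n x
    using rinner_nonneg[OF A, of x] by (simp add: A'_def bop_rep_simps rinner_simps rinner_self)
  then have "\<exists>G. admissible (A' n) B G \<and> (\<forall>X. admissible (A' n) B X \<longrightarrow> X \<le> G)" for n
    by (rule coercive_has_greatest_admissible[OF A' e(1) _ B]) blast
  then obtain G where G: "\<And>n. admissible (A' n) B (G n)"
    and G_max: "\<And>n X. admissible (A' n) B X \<Longrightarrow> X \<le> G n"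
    by metis
  have mono: "admissible C' B X" if "admissible C B X" "0 \<le> C' - C" for C C' X
  proof -
    have "block C' X X B = block C X X B + block (C' - C) 0 0 0"
      by (simp add: block_add)
    then show ?thesis
      using that by (simp add: admissible_def bop_add_nonneg block_diag_nonneg_iff)
  qed
  have "0 \<le> G n" for n
    by (rule G_max) (simp add: admissible_def block_diag_nonneg_iff A' B)
  moreover have "G (Suc n) \<le> G n" for n
  proof (rule G_max, rule mono[OF G])
    have "A' n - A' (Suc n) = real_op (e n - e (Suc n))"
      by (rule bop_eqI) (simp add: A'_def bop_rep_simps scaleR_left_diff_distrib)
    then show "0 \<le> A' n - A' (Suc n)"
      using e(2)[of n] by (simp add: real_op_nonneg)
  qed
  ultimately obtain L where L: "\<And>x. (\<lambda>n. bop_apply (G n) x) \<longlonglongrightarrow> bop_apply L x"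
    by (rule decreasing_strong_limit) blast
  have saL: "adj L = L"
    using L by (rule strong_limit_selfadj) (use G in \<open>simp add: admissible_def\<close>)
  show thesis
  proof (rule that)
    have "0 \<le> rinner (bop_apply (block A L L B) (u, v)) (u, v)" for u v
    proof (rule LIMSEQ_le_const)
      show "(\<lambda>n. rinner (bop_apply (block (A' n) (G n) (G n) B) (u, v)) (u, v))
          \<longlonglongrightarrow> rinner (bop_apply (block A L L B) (u, v)) (u, v)"
      proof -
        have "(\<lambda>n. bop_apply (A' n) u) \<longlonglongrightarrow> bop_apply A u + 0 *\<^sub>R u"
          unfolding A'_def bop_rep_simps
          by (intro tendsto_add tendsto_scaleR tendsto_const \<open>e \<longlonglongrightarrow> 0\<close>)
        then show ?thesis
          unfolding block_form by (intro tendsto_add rinner.tendsto tendsto_const L) simp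
      qed
      show "\<exists>N. \<forall>n\<ge>N. 0 \<le> rinner (bop_apply (block (A' n) (G n) (G n) B) (u, v)) (u, v)"
        using G by (auto simp: admissible_def intro: rinner_nonneg)
    qed
    then show "admissible A B L"
      by (simp add: admissible_def saL bop_nonneg_iff adj_nonneg[OF A] adj_nonneg[OF B])
  next
    fix X assume X: "admissible A B X"
    have "X \<le> G n" for n
      using e(1)[of n] by (intro G_max mono[OF X]) (simp add: A'_def real_op_nonneg)
    then have "rinner (bop_apply X x) x \<le> rinner (bop_apply L x) x" for x
      by (intro LIMSEQ_le_const[OF rinner.tendsto[OF L tendsto_const]]) (auto simp: bop_le_iff)
    then show "X \<le> L"
      using X saL by (simp add: bop_le_iff admissible_def)
  qed
qed

lemma geometric_mean_admissible:
  assumes "0 \<le> A" "0 \<le> B"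
  shows "admissible A B (A #\<^sub>g B)"
proof -
  obtain G where G: "admissible A B G" "\<And>X. admissible A B X \<Longrightarrow> X \<le> G"
    using has_greatest_admissible[OF assms] by blast
  have "(\<lambda>X. X = adj X \<and> 0 \<le> block A X X B) = admissible A B"
    by (simp add: fun_eq_iff admissible_def eq_commute)
  then have "A #\<^sub>g B = G"
    unfolding geometric_mean_def using G by (simp add: Greatest_equality)
  with G(1) show ?thesis by simp
qed

section \<open>Polar decomposition\<close>

text \<open>
  The projection \<open>k\<close> of \<open>x\<close> onto the kernel represents the functional \<open>\<langle>x, v\<rangle>\<close> on it. Orthogonality for
  the complex inner product holds because the kernel is closed under multiplication by \<open>\<i>\<close>.
\<close>

lemma bop_ker_projection:
  obtains k where "k \<in> bop_ker U" and "\<And>v. v \<in> bop_ker U \<Longrightarrow> cinner (x - k) v = 0"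
proof -
  have "subspace (bop_ker U)"
    by (simp add: subspace_def bop_ker_def bop_linear_simps)
  moreover have "closed (bop_ker U)"
    unfolding bop_ker_def
    by (intro closed_Collect_eq continuous_on_const linear_continuous_on bounded_linear_bop_apply)
  ultimately obtain k where k: "k \<in> bop_ker U"
    and ortho: "\<And>v. v \<in> bop_ker U \<Longrightarrow> rinner x v = rinner (bop_apply 1 k) v"
    by (rule coercive_form_represents[of _ 1 1 "rinner x"])
      (simp_all add: bop_rep rinner_self rinner.bounded_linear_right)
  have "cinner (x - k) v = 0" if "v \<in> bop_ker U" for v
  proof -
    have "\<i> *\<^sub>C v \<in> bop_ker U"
      using that by (simp add: bop_ker_def bop_apply_scaleC scaleC_zero_right)
    then have "rinner (x - k) v = 0" "rinner (x - k) (\<i> *\<^sub>C v) = 0"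
      using ortho that by (simp_all add: rinner_simps bop_rep)
    then show ?thesis
      by (simp add: complex_eq_iff rinner_scaleC_ii_right) (simp add: rinner_def)
  qed
  with k show thesis by (rule that)
qed

lemma partial_isometry_adj_mult_le_one:
  assumes U: "partial_isometry U"
  shows "adj U * U \<le> 1"
proof -
  have "(norm (bop_apply U x))\<^sup>2 \<le> (norm x)\<^sup>2" for x
  proof -
    obtain k where k: "k \<in> bop_ker U" "\<And>v. v \<in> bop_ker U \<Longrightarrow> cinner (x - k) v = 0"
      using bop_ker_projection by blast
    have "norm (bop_apply U (x - k)) = norm (x - k)"
      using U k(2) by (simp add: partial_isometry_def)
    then have "norm (bop_apply U x) = norm (x - k)"
      using k(1) by (simp add: bop_ker_def bop_linear_simps)
    moreover have "(norm x)\<^sup>2 = (norm (x - k))\<^sup>2 + (norm k)\<^sup>2"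
      using norm_add_square[of "x - k" k] k by (simp add: rinner_def)
    ultimately show ?thesis by simp
  qed
  then show ?thesis
    by (simp add: bop_le_iff bop_rep rinner_adj' rinner_self)
qed

text \<open>
  The operator \<open>D = 1 - U\<^sup>*U\<close> is positive and its form vanishes at each \<open>z\<close> on which \<open>U\<close> is isometric,
  so \<open>D z = 0\<close> there. The range of \<open>|T|\<close> is orthogonal to the kernel of \<open>|T|\<close>, which is the kernel
  of \<open>U\<close>, whence \<open>U\<^sup>*U |T| = |T|\<close>.
\<close>

lemma polar_decomposition_adj_mult:
  assumes "polar_decomposition T U"
  shows "adj U * T = bop_abs T"
proof -
  have U: "partial_isometry U" and ker: "bop_ker U = bop_ker (bop_abs T)"
    and T: "T = U * bop_abs T"
    using assms by (simp_all add: polar_decomposition_def)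
  define D where "D = 1 - adj U * U"
  have D: "0 \<le> D"
    using partial_isometry_adj_mult_le_one[OF U]
    by (simp only: D_def bop_le_iff_diff_nonneg[of "adj U * U"])
  obtain c where c: "0 < c" "\<And>x. rinner (bop_apply D x) x \<le> c * (norm x)\<^sup>2"
    using nonneg_bound[OF D] by blast
  have "D * bop_abs T = 0"
  proof (rule bop_eqI)
    fix x
    define z where "z = bop_apply (bop_abs T) x"
    have "cinner z v = 0" if "v \<in> bop_ker U" for v
    proof -
      have "cinner z v = cinner x (bop_apply (bop_abs T) v)"
        using rinner_adjoint_iff[of "bop_abs T" "bop_abs T"]
          rinner_selfadj[OF adj_nonneg[OF bop_abs_nonneg[of T]]] unfolding z_def by blast
      also have "\<dots> = cinner x 0" using that unfolding ker by (simp add: bop_ker_def)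
      finally show ?thesis using cinner_commute[of x 0] by (simp add: cinner_zero_left)
    qed
    then have "norm (bop_apply U z) = norm z"
      using U by (simp add: partial_isometry_def)
    then have "rinner (bop_apply D z) z = 0"
      by (simp add: D_def bop_rep rinner_simps rinner_adj' rinner_self)
    then have "bop_apply D z = 0"
      using nonneg_norm_square_le[OF D _ c(2), of z] c(1) by simp
    then show "bop_apply (D * bop_abs T) x = bop_apply 0 x"
      by (simp add: bop_rep z_def)
  qed
  then have "bop_abs T = adj U * (U * bop_abs T)"
    by (simp add: D_def left_diff_distrib mult.assoc)
  with T show ?thesis by simp
qed

section \<open>The inequality\<close>

lemma contraction_le_one:
  assumes P: "0 \<le> P" and "contraction P"
  shows "P \<le> 1"
proof -
  have "norm (bop_apply P x) \<le> norm x" for x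
    using onorm[OF bounded_linear_bop_apply, of P x] assms(2)
      mult_right_mono[of "onorm (bop_apply P)" 1 "norm x"]
    by (simp add: contraction_def)
  then have "rinner (bop_apply P x) x \<le> (norm x)\<^sup>2" for x
    using rinner_le_norm[of "bop_apply P x" x] mult_right_mono[of "norm (bop_apply P x)" "norm x" "norm x"]
    by (force simp: power2_eq_square)
  then show ?thesis
    by (simp add: bop_le_iff adj_nonneg[OF P] bop_rep rinner_self)
qed

theorem theorem3p1:
  fixes \<Phi> :: "'h::complex_hilbert_space bop \<Rightarrow> 'k::complex_hilbert_space bop"
    and A X Y :: "'h bop" and U :: "'k bop"
  assumes "two_positive \<Phi>" and "star_map \<Phi>"
    and "polar_decomposition (\<Phi> (adj X * adj A * Y)) U"
    and "contraction (\<Phi> (adj Y * bop_abs (adj A) * Y))"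
    and "contraction (\<Phi> (adj X * bop_abs A * X))"
  shows "1 - bop_abs (\<Phi> (adj X * adj A * Y))
    \<ge> (adj U * (1 - \<Phi> (adj X * bop_abs A * X)) * U) #\<^sub>g (1 - \<Phi> (adj Y * bop_abs (adj A) * Y))"
proof -
  define P where "P = \<Phi> (adj X * bop_abs A * X)"
  define Q where "Q = \<Phi> (adj Y * bop_abs (adj A) * Y)"
  define T where "T = \<Phi> (adj X * adj A * Y)"
  have polar: "polar_decomposition T U" using assms(3) by (simp add: T_def)
  have "0 \<le> adj (block X 0 0 Y) * block (bop_abs A) (adj A) A (bop_abs (adj A)) * block X 0 0 Y"
    by (rule adj_sandwich_nonneg[OF abs_block_nonneg])
  then have "0 \<le> block (adj X * bop_abs A * X) (adj X * adj A * Y)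
      (adj (adj X * adj A * Y)) (adj Y * bop_abs (adj A) * Y)"
    by (simp add: block_mult mult.assoc)
  moreover have "adj T = \<Phi> (adj (adj X * adj A * Y))"
    using assms(2) by (simp only: star_map_def T_def)
  ultimately have PTQ: "0 \<le> block P T (adj T) Q"
    using assms(1) by (simp only: two_positive_def P_def Q_def T_def)
  then have PQ: "P \<le> 1" "Q \<le> 1"
    using assms(4,5) block_corners_nonneg[OF PTQ]
    by (simp_all add: contraction_le_one P_def Q_def)
  have UT: "adj U * T = bop_abs T"
    by (rule polar_decomposition_adj_mult[OF polar])
  have TU: "adj T * U = bop_abs T"
    using arg_cong[OF UT, of adj] by (simp add: adj_nonneg[OF bop_abs_nonneg])
  have "0 \<le> adj (block U 0 0 1) * block P T (adj T) Q * block U 0 0 1"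
    by (rule adj_sandwich_nonneg[OF PTQ])
  then have abs_block: "0 \<le> block (adj U * P * U) (bop_abs T) (bop_abs T) Q"
    by (simp add: block_mult UT TU)
  define G where "G = (adj U * (1 - P) * U) #\<^sub>g (1 - Q)"
  have "admissible (adj U * (1 - P) * U) (1 - Q) G"
    unfolding G_def using PQ
    by (intro geometric_mean_admissible adj_sandwich_nonneg)
      (simp_all add: bop_le_iff_diff_nonneg[symmetric])
  then have "0 \<le> block (adj U * (1 - P) * U) G G (1 - Q)"
    by (simp add: admissible_def)
  from bop_add_nonneg[OF this abs_block]
  have "0 \<le> block (adj U * U) (G + bop_abs T) (G + bop_abs T) 1"
    by (simp add: block_add left_diff_distrib right_diff_distrib mult.assoc)
  moreover have "adj U * U \<le> 1"
    using polar by (simp add: polar_decomposition_def partial_isometry_adj_mult_le_one)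
  ultimately have "G + bop_abs T \<le> 1"
    by (rule nonneg_block_one_imp_le)
  then have "0 \<le> 1 - (G + bop_abs T)"
    by (rule bop_le_iff_diff_nonneg[THEN iffD1])
  also have "1 - (G + bop_abs T) = 1 - bop_abs T - G" by simp
  finally have "G \<le> 1 - bop_abs T"
    by (rule bop_le_iff_diff_nonneg[THEN iffD2])
  then show ?thesis by (simp add: G_def P_def Q_def T_def)
qed

end
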